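(* A finite torsion-free associative conformal algebra over a field $\Bbbk$ of characteristic zero can be embedded (by an injective homomorphism of conformal algebras) into a finitely generated associative conformal algebra of no more than linear growth (i.e., of Gelfand–Kirillov dimension at most $1$) that has a two-sided unit.
   Context: $\Bbbk$ is a field of characteristic $0$ and $H=\Bbbk[D]$. A conformal algebra is a left unital $H$-module $C$ with $\Bbbk$-bilinear products $a_{(n)}b$, $n\in\mathbb Z_{\ge 0}$, such that for all $a,b\in C$: $a_{(n)}b=0$ for almost all $n$; $(Da)_{(n)}b=-n\,a_{(n-1)}b$; $a_{(n)}(Db)=D(a_{(n)}b)+n\,a_{(n-1)}b$ (products with negative index are zero). It is associative if $a_{(n)}(b_{(m)}c)=\sum_{s\ge0}\binom ns (a_{(n-s)}b)_{(m+s)}c$ for all $a,b,c\in C$, $n,m\ge0$. It is finite if it is finitely generated as an $H$-module, and torsion-free if it has no torsion as an $H$-module. Homomorphisms are $H$-linear maps preserving all $n$-products. $N_C(a,b)$ denotes the minimal non-negative integer such that $a_{(n)}b=0$ for all $n\ge N_C(a,b)$, and $\{a_{(n)}b\}=\sum_{s\ge0}\frac{(-1)^{n+s}}{s!}D^s(a_{(n+s)}b)$. An element $e$ of an associative conformal algebra $C$ is a left unit if $e_{(0)}x=x$ for all $x\in C$ and $N_C(e,e)=1$; a right unit if $\{x_{(0)}e\}=x$ for all $x\in C$ and $N_C(e,e)=1$; a two-sided unit if it is both a left and a right unit. A conformal algebra $C$ is finitely generated if it is generated, using all $n$-products and $D$, by a finite set $V$. For such $C$ let $V(n)$ be the $H$-submodule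 spanned by all conformal monomials in $V$ (iterated products of elements of $V$ with arbitrary indices and bracketing) of length at most $n$; it is finitely generated over $H$. The Gelfand–Kirillov dimension of $C$ is $\limsup_{n\to\infty}\frac{\ln \operatorname{rank}V(n)}{\ln n}$, which does not depend on $V$. Linear growth means Gelfand–Kirillov dimension $1$. *)

theory Defs
  imports
    Complex_Main
    "HOL-Computational_Algebra.Polynomial"
    "HOL-Library.Extended_Real"
    "HOL-Library.Liminf_Limsup"
begin

(* The polynomial ring H = k[D] is the type 'k poly, with D = [:0, 1:] and with the scalar r of k
   embedded as [:r:].  An H-module is a type 'c with a scalar multiplication satisfying the
   library locale module; a conformal algebra occupies the whole type 'c. *)

locale conformal_algebra = module scale
  for scale :: "'k::field_char_0 poly \<Rightarrow> 'c::ab_group_add \<Rightarrow> 'c" +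
  fixes nprod :: "nat \<Rightarrow> 'c \<Rightarrow> 'c \<Rightarrow> 'c"
  assumes nprod_add_left: "nprod n (a + b) c = nprod n a c + nprod n b c"
    and nprod_add_right: "nprod n a (b + c) = nprod n a b + nprod n a c"
    and nprod_scalar_left: "nprod n (scale [:r:] a) b = scale [:r:] (nprod n a b)"
    and nprod_scalar_right: "nprod n a (scale [:r:] b) = scale [:r:] (nprod n a b)"
    and nprod_locality: "finite {n. nprod n a b \<noteq> 0}"
    (* For n = 0 the truncated index n - 1 is harmless: its coefficient is 0. *)
    and nprod_D_left: "nprod n (scale [:0, 1:] a) b = - scale (of_nat n) (nprod (n - 1) a b)"
    and nprod_D_right: "nprod n a (scale [:0, 1:] b) =
      scale [:0, 1:] (nprod n a b) + scale (of_nat n) (nprod (n - 1) a b)"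
begin

definition finite_algebra :: bool where
  "finite_algebra \<longleftrightarrow> (\<exists>S. finite S \<and> span S = UNIV)"

definition torsion_free :: bool where
  "torsion_free \<longleftrightarrow> (\<forall>h a. scale h a = 0 \<longrightarrow> h = 0 \<or> a = 0)"

definition loc :: "'c \<Rightarrow> 'c \<Rightarrow> nat" where
  "loc a b = (LEAST N. \<forall>n\<ge>N. nprod n a b = 0)"

(* The product {a_(n) b}.  The range of summation is finite by locality, and omits only
   vanishing terms. *)
definition curly :: "nat \<Rightarrow> 'c \<Rightarrow> 'c \<Rightarrow> 'c" where
  "curly n a b = (\<Sum>s\<in>{s. nprod (n + s) a b \<noteq> 0}.
     scale (monom ((-1) ^ (n + s) / fact s) s) (nprod (n + s) a b))"

definition left_unit :: "'c \<Rightarrow> bool" where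
  "left_unit e \<longleftrightarrow> (\<forall>x. nprod 0 e x = x) \<and> loc e e = 1"

definition right_unit :: "'c \<Rightarrow> bool" where
  "right_unit e \<longleftrightarrow> (\<forall>x. curly 0 x e = x) \<and> loc e e = 1"

definition two_sided_unit :: "'c \<Rightarrow> bool" where
  "two_sided_unit e \<longleftrightarrow> left_unit e \<and> right_unit e"

definition subalgebra :: "'c set \<Rightarrow> bool" where
  "subalgebra S \<longleftrightarrow> subspace S \<and> (\<forall>n. \<forall>a\<in>S. \<forall>b\<in>S. nprod n a b \<in> S)"

definition generates :: "'c set \<Rightarrow> bool" where
  "generates V \<longleftrightarrow> subalgebra hull V = UNIV"

definition finitely_generated :: bool where
  "finitely_generated \<longleftrightarrow> (\<exists>V. finite V \<and> generates V)"

(* monomial V l a: a is the value of a bracketed conformal monomial of length l in V. *)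
inductive monomial :: "'c set \<Rightarrow> nat \<Rightarrow> 'c \<Rightarrow> bool" for V where
  monomial_gen: "v \<in> V \<Longrightarrow> monomial V 1 v"
| monomial_nprod: "monomial V l a \<Longrightarrow> monomial V m b \<Longrightarrow> monomial V (l + m) (nprod n a b)"

definition filtration :: "'c set \<Rightarrow> nat \<Rightarrow> 'c set" where
  "filtration V n = span {a. \<exists>l\<le>n. monomial V l a}"

(* Maximal number of H-independent elements, i.e. the dimension over the fraction field of H after
   extension of scalars.  Only meaningful for submodules of finitely generated modules, where the
   supremum is over a bounded set. *)
definition rank :: "'c set \<Rightarrow> nat" where
  "rank M = Sup (card ` {B. B \<subseteq> M \<and> finite B \<and> independent B})"

definition growth_exponent :: "'c set \<Rightarrow> ereal" where
  "growth_exponent V = limsup (\<lambda>n. ereal (ln (real (rank (filtration V n))) / ln (real n)))"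

(* The Gelfand-Kirillov dimension, for finitely generated algebras; the growth exponent does not
   depend on the finite generating set.  As ln 0 = 0 here, the algebras with all ranks 0
   get dimension 0. *)
definition gk_dim :: ereal where
  "gk_dim = growth_exponent (SOME V. finite V \<and> generates V)"

end

locale assoc_conformal_algebra = conformal_algebra +
  (* The binomial coefficient vanishes for s > n. *)
  assumes nprod_assoc: "nprod n a (nprod m b c) =
    (\<Sum>s\<le>n. scale (of_nat (n choose s)) (nprod (m + s) (nprod (n - s) a b) c))"

locale conformal_hom =
  source: conformal_algebra scale nprod + target: conformal_algebra scale' nprod' +
  module_hom scale scale' f
  for scale :: "'k::field_char_0 poly \<Rightarrow> 'c::ab_group_add \<Rightarrow> 'c"
    and nprod :: "nat \<Rightarrow> 'c \<Rightarrow> 'c \<Rightarrow> 'c"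
    and scale' :: "'k poly \<Rightarrow> 'd::ab_group_add \<Rightarrow> 'd"
    and nprod' :: "nat \<Rightarrow> 'd \<Rightarrow> 'd \<Rightarrow> 'd"
    and f :: "'c \<Rightarrow> 'd" +
  assumes hom_nprod: "f (nprod n a b) = nprod' n (f a) (f b)"

(* "There is a finitely generated conformal algebra with a two-sided unit such that ..." is an
   existential over conformal algebras on an arbitrary type; HOL can only quantify over structures on
   a fixed type.  The type 'k poly poly loses nothing, since module structure and products on it
   are arbitrary: a finitely generated algebra has countable dimension over k, and one with a
   unit e has infinite dimension, because torsion elements have zero products with everything and
   hence H e is free.  So, as a vector space over k, any such algebra is isomorphic to
   'k poly poly, and its structure can be transported there. *)

end

theory Submission
  imports Defs "HOL-Real_Asymp.Real_Asymp" "HOL-Library.Function_Algebras"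
begin

text \<open>
  Let \<open>C\<close> be generated over \<open>H\<close> by a finite set \<open>S\<close>.  The coefficient algebra of \<open>C\<close>, spanned by
  symbols \<open>c(n)\<close> subject to \<open>(D c)(n) = - n c(n - 1)\<close>, is an ordinary associative algebra.  The linear
  functionals on it (extended by a unit) that vanish on all \<open>s(n)\<close> with \<open>s \<in> S\<close> and \<open>n \<ge> K\<close> form a
  finite-dimensional space.  As the products \<open>s\<^sub>(\<^sub>n\<^sub>) t\<close> with \<open>s, t \<in> S\<close> involve \<open>D\<close> only to a bounded
  power, for large \<open>K\<close> this space contains a subspace \<open>U\<close> that is stable under the coefficient algebra
  and still separates the elements of \<open>C\<close>.  Hence every \<open>c(n)\<close> acts on \<open>U\<close> by an \<open>r \<times> r\<close> matrix
  \<open>\<tau> c n\<close>, which vanishes for large \<open>n\<close>, and \<open>c\<close> is mapped to the sum of all \<open>(-D)\<^sup>n / n!\<close> times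
  \<open>\<tau> c n\<close>: an embedding of \<open>C\<close> into the current algebra over the \<open>r \<times> r\<close> matrices.  We enlarge the
  matrices to \<open>M\<^sub>r(k[x])\<close> only because its current algebra is, as an \<open>H\<close>-module, naturally the whole type
  of polynomials in \<open>D\<close> over polynomials; its Gelfand-Kirillov dimension is at most 1.
\<close>

section \<open>Binomial sums\<close>

text \<open>\<open>binsum n h\<close> is the umbral power \<open>(X + Y)\<^sup>n\<close>, where \<open>X\<^sup>s Y\<^sup>k\<close> stands for \<open>h s k\<close>.\<close>

definition binsum :: "nat \<Rightarrow> (nat \<Rightarrow> nat \<Rightarrow> 'a::comm_ring_1) \<Rightarrow> 'a" where
  "binsum n h = (\<Sum>s\<le>n. of_nat (n choose s) * h s (n - s))"

lemma binsum_0 [simp]: "binsum 0 h = h 0 0"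
  by (simp add: binsum_def)

text \<open>Pascal's rule: one factor \<open>X + Y\<close> is split off. It drives the inductions on
  \<open>n\<close> below.\<close>

lemma binsum_Suc: "binsum (Suc n) h = binsum n (\<lambda>s k. h s (Suc k) + h (Suc s) k)"
proof -
  have "(\<Sum>s\<le>n. of_nat (n choose s) * h s (Suc n - s)) =
      (\<Sum>s\<le>Suc n. of_nat (n choose s) * h s (Suc n - s))"
    by (simp add: binomial_eq_0)
  also have "\<dots> = h 0 (Suc n) + (\<Sum>s\<le>n. of_nat (n choose Suc s) * h (Suc s) (n - s))"
    by (subst sum.atMost_Suc_shift) simp
  finally have *: "h 0 (Suc n) + (\<Sum>s\<le>n. of_nat (n choose Suc s) * h (Suc s) (n - s)) =
      (\<Sum>s\<le>n. of_nat (n choose s) * h s (Suc (n - s)))"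
    by (simp add: Suc_diff_le)
  have "binsum (Suc n) h = h 0 (Suc n) + (\<Sum>s\<le>n. of_nat (n choose Suc s) * h (Suc s) (n - s)) +
      (\<Sum>s\<le>n. of_nat (n choose s) * h (Suc s) (n - s))"
    unfolding binsum_def by (subst sum.atMost_Suc_shift) (simp add: algebra_simps sum.distrib)
  then show ?thesis
    unfolding * by (simp add: binsum_def distrib_left sum.distrib)
qed

lemma binsum_add: "binsum n (\<lambda>s k. g s k + h s k) = binsum n g + binsum n h"
  by (simp add: binsum_def distrib_left sum.distrib)

text \<open>Umbrally, the derivative of \<open>(X + Y)^n\<close> by \<open>Y\<close>. At
  \<open>k = 0\<close> the truncated index \<open>k - 1\<close> is harmless, as its coefficient
  vanishes.\<close>

lemma binsum_absorb: "of_nat n * binsum (n - 1) h = binsum n (\<lambda>s k. of_nat k * h s (k - 1))"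
proof (cases n)
  case (Suc l)
  have *: "of_nat (Suc l choose s) * (of_nat (Suc l - s) * x) = of_nat (Suc l) * (of_nat (l choose s) * x)"
    for s and x :: 'a
  proof -
    have "of_nat ((Suc l - s) * (Suc l choose s)) = (of_nat (Suc l * (l choose s)) :: 'a)"
      by (subst binomial_absorb_comp) simp
    then have "(of_nat (Suc l - s) * of_nat (Suc l choose s)) * x = (of_nat (Suc l) * of_nat (l choose s)) * x"
      by (simp only: of_nat_mult)
    then show ?thesis
      by (simp only: mult.assoc mult.left_commute)
  qed
  show ?thesis
    unfolding binsum_def Suc sum.atMost_Suc diff_Suc_1 * by (simp add: sum_distrib_left binomial_eq_0)
qed simp

lemma binsum_cong: "(\<And>s k. s + k = n \<Longrightarrow> g s k = h s k) \<Longrightarrow> binsum n g = binsum n h"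
  unfolding binsum_def by (intro sum.cong) auto

lemma binsum_zero [simp]: "binsum n (\<lambda>s k. 0) = 0"
  by (simp add: binsum_def)

lemma binsum_mult_left: "binsum n (\<lambda>s k. c * h s k) = c * binsum n h"
  by (simp add: binsum_def sum_distrib_left mult.left_commute)

lemma binsum_minus: "binsum n (\<lambda>s k. - h s k) = - binsum n h"
  by (simp add: binsum_def sum_negf)

lemma binsum_sum: "binsum n (\<lambda>s k. \<Sum>i\<in>A. h s k i) = (\<Sum>i\<in>A. binsum n (\<lambda>s k. h s k i))"
proof (induction A rule: infinite_finite_induct)
  case (insert x A)
  then show ?case by (simp add: binsum_add)
qed simp_all

lemma binsum_commute: "binsum n h = binsum n (\<lambda>s k. h k s)"
  unfolding binsum_def
  by (rule sum.reindex_bij_witness[of _ "\<lambda>s. n - s" "\<lambda>s. n - s"]) (auto simp: binomial_symmetric[symmetric])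

lemma binsum_absorb_left: "of_nat n * binsum (n - 1) h = binsum n (\<lambda>s k. of_nat s * h (s - 1) k)"
  using binsum_absorb[of n "\<lambda>s k. h k s"] binsum_commute[of "n - 1" h]
    binsum_commute[of n "\<lambda>s k. of_nat s * h (s - 1) k"] by simp

lemma binsum_swap:
  "binsum m (\<lambda>t i. binsum n (\<lambda>p w. f t i p w)) = binsum n (\<lambda>p w. binsum m (\<lambda>t i. f t i p w))"
  unfolding binsum_def sum_distrib_left by (subst sum.swap) (simp add: mult.left_commute)

text \<open>Both sides are the umbral power \<open>(X + Y + Z)^n\<close>, bracketed in two
  ways.\<close>

lemma binsum_assoc:
  "binsum n (\<lambda>s k. binsum k (\<lambda>v w. g s v w)) = binsum n (\<lambda>p w. binsum p (\<lambda>s v. g s v w))"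
proof (induction n arbitrary: g)
  case (Suc n)
  have "binsum (Suc n) (\<lambda>s k. binsum k (\<lambda>v w. g s v w)) =
      binsum n (\<lambda>s k. binsum k (\<lambda>v w. g s v (Suc w) + g s (Suc v) w + g (Suc s) v w))"
    by (simp add: binsum_Suc binsum_add)
  also have "\<dots> = binsum n (\<lambda>p w. binsum p (\<lambda>s v. g s v (Suc w) + g s (Suc v) w + g (Suc s) v w))"
    by (rule Suc.IH)
  also have "\<dots> = binsum (Suc n) (\<lambda>p w. binsum p (\<lambda>s v. g s v w))"
    by (simp add: binsum_Suc binsum_add add.assoc)
  finally show ?case .
qed simp

text \<open>Umbrally, \<open>(X + Y)^m (X + Y)^p = (X + Y)^(m + p)\<close>.\<close>

lemma binsum_binsum_add:
  "binsum m (\<lambda>t i. binsum p (\<lambda>s v. h (t + s) (i + v))) = binsum (m + p) h"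
proof (induction m arbitrary: h)
  case (Suc m)
  have "binsum (Suc m) (\<lambda>t i. binsum p (\<lambda>s v. h (t + s) (i + v))) =
      binsum m (\<lambda>t i. binsum p (\<lambda>s v. h (t + s) (Suc (i + v)) + h (Suc (t + s)) (i + v)))"
    by (simp add: binsum_Suc binsum_add)
  also have "\<dots> = binsum (m + p) (\<lambda>s k. h s (Suc k) + h (Suc s) k)"
    by (rule Suc.IH)
  finally show ?case
    by (simp add: binsum_Suc)
qed simp

text \<open>With \<open>g l t\<close> standing for \<open>L^l T^t\<close>, the left side is
  \<open>((T + L) - T)^n = L^n\<close>. It later recovers a single \<open>n\<close>-product from
  products of coefficient symbols.\<close>

lemma binsum_inverse:
  "binsum n (\<lambda>i k. (-1) ^ k * binsum i (\<lambda>s l. g l (k + s))) = g n (0 :: nat)"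
proof (induction n arbitrary: g)
  case (Suc n)
  have "binsum (Suc n) (\<lambda>i k. (-1) ^ k * binsum i (\<lambda>s l. g l (k + s))) =
      binsum n (\<lambda>i k. (-1) ^ k * binsum i (\<lambda>s l. g (Suc l) (k + s)))"
    by (simp add: binsum_Suc binsum_add distrib_left)
  also have "\<dots> = g (Suc n) 0"
    by (rule Suc.IH)
  finally show ?case .
qed simp

section \<open>Current conformal algebras\<close>

text \<open>A second multiplication \<open>mul\<close> on the vector space of polynomials, for which the polynomials of
  degree less than \<open>(d + 1) R\<close>, a space of dimension linear in \<open>d\<close>, are the \<open>d\<close>-th term of a filtration,
  and which is generated by \<open>xi\<close> and the first \<open>R\<close> monomials.\<close>

locale poly_algebra =
  fixes mul :: "'k::field_char_0 poly \<Rightarrow> 'k poly \<Rightarrow> 'k poly" and one xi :: "'k poly" and R :: nat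
  assumes mul_add_left: "mul (a + b) c = mul a c + mul b c"
    and mul_add_right: "mul a (b + c) = mul a b + mul a c"
    and mul_smult_left: "mul (smult r a) b = smult r (mul a b)"
    and mul_smult_right: "mul a (smult r b) = smult r (mul a b)"
    and mul_assoc: "mul (mul a b) c = mul a (mul b c)"
    and mul_one_left: "mul one a = a"
    and mul_one_right: "mul a one = a"
    and one_nonzero: "one \<noteq> 0"
    and R_pos: "R > 0"
    and degree_mul: "degree a < Suc d * R \<Longrightarrow> degree b < Suc e * R \<Longrightarrow>
      degree (mul a b) < Suc (d + e) * R"
    and mul_xi: "mul xi (monom 1 m) = monom 1 (m + R)"

text \<open>The outer variable plays the role of D, and the coefficients are elements of the algebra
  that is to carry \<open>mul\<close>. The ordinary product serves here because it multiplies
  coefficients only by constants of k.\<close>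

definition scl :: "'k::field_char_0 poly \<Rightarrow> 'k poly poly \<Rightarrow> 'k poly poly" where
  "scl h u = map_poly (\<lambda>r. [:r:]) h * u"

lemma map_poly_const_add: "map_poly (\<lambda>r. [:r:]) (g + h) =
    map_poly (\<lambda>r. [:r:]) g + map_poly (\<lambda>r. [:r:]) (h :: 'k::field_char_0 poly)"
  by (rule poly_eqI) (simp add: coeff_map_poly)

lemma const_poly_sum: "[:sum f A:] = (\<Sum>i\<in>A. [:f i:])"
proof (induction A rule: infinite_finite_induct)
  case (insert x A)
  then show ?case by (simp add: insert.IH[symmetric])
qed auto

lemma map_poly_const_mult: "map_poly (\<lambda>r. [:r:]) (g * h) =
    map_poly (\<lambda>r. [:r:]) g * map_poly (\<lambda>r. [:r:]) (h :: 'k::field_char_0 poly)"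
proof (rule poly_eqI)
  fix n
  show "coeff (map_poly (\<lambda>r. [:r:]) (g * h)) n =
    coeff (map_poly (\<lambda>r. [:r:]) g * map_poly (\<lambda>r. [:r:]) h) n"
    by (simp only: coeff_map_poly coeff_mult const_poly_sum pCons_0_0) (simp add: ac_simps)
qed

interpretation scl: module scl
proof
  fix g h :: "'k::field_char_0 poly" and u v :: "'k poly poly"
  show "scl g (u + v) = scl g u + scl g v"
    by (simp only: scl_def distrib_left)
  show "scl (g + h) u = scl g u + scl h u"
    by (simp only: scl_def map_poly_const_add distrib_right)
  show "scl g (scl h u) = scl (g * h) u"
    by (simp only: scl_def map_poly_const_mult mult.assoc)
  have "map_poly (\<lambda>r. [:r:]) (1 :: 'k poly) = 1"
    by (simp only: map_poly_1 pCons_one)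
  then show "scl 1 u = u"
    by (simp only: scl_def mult_1)
qed

lemma scl_const: "scl [:r:] u = smult [:r:] u"
  by (simp add: scl_def map_poly_pCons pCons_one)

lemma scl_D: "scl [:0, 1:] u = pCons 0 u"
  by (simp add: scl_def map_poly_pCons pCons_one)

lemma scl_of_nat: "scl (of_nat n) u = of_nat n * u"
  by (simp add: of_nat_poly scl_const)

lemma scl_monom: "scl (monom r n) u = monom [:r:] n * u"
  by (simp add: scl_def map_poly_monom)

lemma pCons_eq_scl: "pCons a u = [:a:] + scl [:0, 1:] u"
  by (simp add: scl_D)

context poly_algebra
begin

lemma mul_zero_left [simp]: "mul 0 a = 0"
  using mul_add_left[of 0 0 a] by simp

lemma mul_zero_right [simp]: "mul a 0 = 0"
  using mul_add_right[of a 0 0] by simp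

definition lmul :: "'k poly \<Rightarrow> 'k poly poly \<Rightarrow> 'k poly poly" where
  "lmul a u = map_poly (mul a) u"

lemma coeff_lmul [simp]: "coeff (lmul a u) n = mul a (coeff u n)"
  by (simp add: lmul_def coeff_map_poly)

lemma lmul_add_left: "lmul (a + b) u = lmul a u + lmul b u"
  by (rule poly_eqI) (simp add: mul_add_left)

lemma lmul_add_right: "lmul a (u + v) = lmul a u + lmul a v"
  by (rule poly_eqI) (simp add: mul_add_right)

lemma lmul_zero [simp]: "lmul 0 u = 0" "lmul a 0 = 0"
  by (rule poly_eqI, simp)+

lemma lmul_smult_left: "lmul (smult r a) u = smult [:r:] (lmul a u)"
  by (rule poly_eqI) (simp add: mul_smult_left)

lemma lmul_smult_right: "lmul a (smult [:r:] u) = smult [:r:] (lmul a u)"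
  by (rule poly_eqI) (simp add: mul_smult_right)

lemma lmul_lmul: "lmul a (lmul b u) = lmul (mul a b) u"
  by (rule poly_eqI) (simp add: mul_assoc)

lemma lmul_of_nat: "lmul a (of_nat n * u) = of_nat n * lmul a u"
  using lmul_smult_right[of a "of_nat n" u] by (simp add: of_nat_poly)

lemma lmul_const: "lmul a [:b:] = [:mul a b:]"
  by (rule poly_eqI) (simp split: nat.splits add: coeff_pCons)

lemma lmul_shift: "lmul a (pCons 0 u) = pCons 0 (lmul a u)"
  by (rule poly_eqI) (simp split: nat.splits add: coeff_pCons)

lemma pderiv_lmul: "pderiv (lmul a u) = lmul a (pderiv u)"
proof (rule poly_eqI)
  fix n
  have "of_nat (Suc n) * mul a b = mul a (of_nat (Suc n) * b)" for b
    using mul_smult_right[of a "of_nat (Suc n)" b] by (simp add: of_nat_poly)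
  then show "coeff (pderiv (lmul a u)) n = coeff (lmul a (pderiv u)) n"
    by (simp only: coeff_pderiv coeff_lmul)
qed

end

section \<open>Iterated derivatives of polynomials\<close>

lemma smult_sum_right: "smult r (sum f A) = (\<Sum>i\<in>A. smult r (f i))"
  by (induction A rule: infinite_finite_induct) (auto simp: smult_add_right)

lemma pderiv_pow_0 [simp]: "(pderiv ^^ n) (0 :: 'a::{comm_semiring_1,semiring_no_zero_divisors} poly) = 0"
  by (induction n) auto

lemma pderiv_pow_add: "(pderiv ^^ n) (u + v) = (pderiv ^^ n) u + (pderiv ^^ n) (v :: 'a::idom poly)"
  by (induction n) (auto simp: pderiv_add)

lemma pderiv_pow_smult: "(pderiv ^^ n) (smult r u) = smult r ((pderiv ^^ n) (u :: 'a::idom poly))"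
  by (induction n) (auto simp: pderiv_smult)

text \<open>The Leibniz rule for a factor D, all of whose derivatives beyond the first
  vanish.\<close>

lemma pderiv_pow_shift:
  "(pderiv ^^ n) (pCons 0 u) = pCons 0 ((pderiv ^^ n) u) + of_nat n * (pderiv ^^ (n - 1)) (u :: 'a::idom poly)"
proof (induction n)
  case (Suc n)
  show ?case
  proof (cases n)
    case 0
    then show ?thesis by (simp add: pderiv_pCons)
  next
    case (Suc m)
    then show ?thesis using Suc.IH Suc
      by (simp add: pderiv_add pderiv_pCons pderiv_mult pderiv_of_nat algebra_simps)
  qed
qed simp

lemma pderiv_pow_const: "(pderiv ^^ n) [:a:] = (if n = 0 then [:a:] else 0)"
  for a :: "'a::idom"
  by (cases n) (simp_all add: funpow_Suc_right pderiv_pCons del: funpow.simps)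

lemma pderiv_pow_eq_0: "degree u < n \<Longrightarrow> (pderiv ^^ n) (u :: 'a::idom poly) = 0"
proof (induction u arbitrary: n)
  case (pCons a u)
  have *: "pCons a u = [:a:] + pCons 0 u" by simp
  show ?case
  proof (cases "u = 0")
    case True
    then show ?thesis using pCons by (simp add: pderiv_pow_const)
  next
    case False
    then have "(pderiv ^^ n) u = 0" "(pderiv ^^ (n - 1)) u = 0" "n \<noteq> 0"
      using pCons by auto
    then show ?thesis
      unfolding * pderiv_pow_add pderiv_pow_shift by (simp add: pderiv_pow_const)
  qed
qed simp

context poly_algebra
begin

text \<open>The value at \<open>D\<close> of the coefficient of \<open>\<lambda>\<^sup>n / n!\<close> in \<open>u(-\<lambda>) v(D + \<lambda>)\<close>.\<close>
definition cprod :: "nat \<Rightarrow> 'k poly poly \<Rightarrow> 'k poly poly \<Rightarrow> 'k poly poly" where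
  "cprod n u v = (\<Sum>i\<le>n. (-1) ^ i * of_nat (fact i * (n choose i)) *
     lmul (coeff u i) ((pderiv ^^ (n - i)) v))"

lemma cprod_add_left: "cprod n (u + v) w = cprod n u w + cprod n v w"
  by (simp only: cprod_def coeff_add lmul_add_left distrib_left sum.distrib)

lemma cprod_add_right: "cprod n u (v + w) = cprod n u v + cprod n u w"
  by (simp only: cprod_def pderiv_pow_add lmul_add_right distrib_left sum.distrib)

lemma cprod_zero [simp]: "cprod n 0 u = 0" "cprod n u 0 = 0"
  by (simp_all add: cprod_def)

lemma cprod_smult_left: "cprod n (smult [:r:] u) v = smult [:r:] (cprod n u v)"
  proof -
  have "lmul (coeff (smult [:r:] u) i) w = smult [:r:] (lmul (coeff u i) w)" for i w
    using lmul_smult_left[of r "coeff u i" w] by simp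
  then show ?thesis
    by (simp only: cprod_def smult_sum_right mult_smult_right)
qed

lemma cprod_smult_right: "cprod n u (smult [:r:] v) = smult [:r:] (cprod n u v)"
  by (simp only: cprod_def pderiv_pow_smult lmul_smult_right smult_sum_right mult_smult_right)

lemma cprod_of_nat_left: "cprod n (of_nat k * u) v = of_nat k * cprod n u v"
  using cprod_smult_left[of n "of_nat k"] by (simp add: of_nat_poly)

text \<open>Splits the left factor as \<open>a + D u\<close>: a constant acts through the
  \<open>n\<close>-th derivative, and D on the left lowers the index with the factor
  \<open>- n\<close>. This recursion carries the later inductions on the left factor.\<close>

lemma cprod_pCons_left:
  "cprod n (pCons a u) v = lmul a ((pderiv ^^ n) v) - of_nat n * cprod (n - 1) u v"
proof (cases n)
  case 0
  then show ?thesis by (simp add: cprod_def)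
next
  case (Suc m)
  \<comment> \<open>Absorption; it brings out the factor \<open>n\<close> when the summation index
    is shifted.\<close>
  have *: "fact (Suc i) * (Suc m choose Suc i) = Suc m * (fact i * (m choose i))" for i
    using Suc_times_binomial_eq[of m i] by (simp add: algebra_simps)
  define g where "g i = (-1) ^ i * of_nat (fact i * (n choose i)) *
    lmul (coeff (pCons a u) i) ((pderiv ^^ (n - i)) v)" for i
  have g_Suc: "g (Suc i) = - (of_nat n * ((-1) ^ i * of_nat (fact i * (m choose i)) *
    lmul (coeff u i) ((pderiv ^^ (m - i)) v)))" for i
    unfolding g_def Suc * coeff_pCons_Suc diff_Suc_Suc of_nat_mult[of "Suc m"] power_Suc
    by (simp only: mult_minus_left mult_minus_right mult_1 mult.assoc mult.left_commute[of _ "of_nat (Suc m)"])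
  have "cprod n (pCons a u) v = g 0 + (\<Sum>i\<le>m. g (Suc i))"
    unfolding cprod_def g_def Suc by (rule sum.atMost_Suc_shift)
  also have "(\<Sum>i\<le>m. g (Suc i)) = - (of_nat n * cprod m u v)"
    by (simp only: g_Suc cprod_def sum_negf sum_distrib_left)
  finally show ?thesis
    by (simp add: g_def Suc)
qed

lemma cprod_const_left: "cprod n [:a:] v = lmul a ((pderiv ^^ n) v)"
  by (simp add: cprod_pCons_left)

lemma cprod_shift_left: "cprod n (pCons 0 u) v = - (of_nat n * cprod (n - 1) u v)"
  by (simp add: cprod_pCons_left)

lemma cprod_shift_right: "cprod n u (pCons 0 v) = pCons 0 (cprod n u v) + of_nat n * cprod (n - 1) u v"
proof (induction u arbitrary: n)
  case (pCons a u)
  \<comment> \<open>Writing the shift as multiplication by some \<open>d\<close> makes the claim a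
    ring identity.\<close>
  obtain d :: "'k poly poly" where shift: "pCons 0 w = d * w" for w
    using that[of "[:0, 1:]"] by simp
  have ring: "d * A + p * B - p * (d * C + q * E) = d * (A - p * C) + p * (B - q * E)"
    for d p q A B C E :: "'k poly poly"
    by (simp add: algebra_simps)
  show ?case
    unfolding cprod_pCons_left pCons.IH pderiv_pow_shift lmul_add_right lmul_shift lmul_of_nat
    unfolding shift by (rule ring)
qed simp

text \<open>In each summand either \<open>i\<close> exceeds the degree of \<open>u\<close> or
  \<open>n - i\<close> exceeds that of \<open>v\<close>.\<close>

lemma cprod_eq_0:
  assumes "n > degree u + degree v"
  shows "cprod n u v = 0"
  unfolding cprod_def
proof (rule sum.neutral, rule ballI)
  fix i assume "i \<in> {..n}"
  show "(-1) ^ i * of_nat (fact i * (n choose i)) * lmul (coeff u i) ((pderiv ^^ (n - i)) v) = 0"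
    using assms by (cases "i \<le> degree u") (auto simp: coeff_eq_0 pderiv_pow_eq_0)
qed


lemma cprod_lmul_left: "cprod n (lmul a u) v = lmul a (cprod n u v)"
proof (induction u arbitrary: n)
  case (pCons b u)
  have *: "lmul a (pCons b u) = pCons (mul a b) (lmul a u)"
    by (rule poly_eqI) (simp add: coeff_pCons split: nat.splits)
  have "lmul a (x - y) = lmul a x - lmul a y" for x y
    using lmul_add_right[of a "x - y" y] by simp
  then show ?case
    unfolding * cprod_pCons_left pCons.IH by (simp add: lmul_lmul lmul_of_nat)
qed simp

lemma pderiv_of_nat_mult: "pderiv (of_nat k * (u :: 'k poly poly)) = of_nat k * pderiv u"
  by (simp add: pderiv_mult pderiv_of_nat)

text \<open>On \<open>u(-\<lambda>) v(D + \<lambda>)\<close> the derivatives by \<open>D\<close> and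
  by \<open>\<lambda>\<close> differ only by the term in which \<open>u\<close> is differentiated,
  and the derivative by \<open>\<lambda>\<close> raises the index of the coefficient by one.\<close>

lemma pderiv_cprod: "pderiv (cprod m u v) = cprod m (pderiv u) v + cprod (Suc m) u v"
proof (induction u arbitrary: m)
  case (pCons a u)
  \<comment> \<open>For \<open>m = 0\<close> the truncated index is off by one, but the factor is
    zero.\<close>
  have *: "of_nat m * cprod (Suc (m - 1)) u v = of_nat m * cprod m u v"
    by (cases m) simp_all
  show ?case
    unfolding cprod_pCons_left pderiv_pCons pderiv_diff pderiv_of_nat_mult pCons.IH
      cprod_add_left cprod_shift_left pderiv_lmul distrib_left *
    by (simp add: algebra_simps)
qed simp

text \<open>Iterating \<open>pderiv_cprod\<close> raises a sum of two commuting operations,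
  increasing the index and differentiating \<open>u\<close>, to the power \<open>n\<close>.\<close>

lemma pderiv_pow_cprod:
  "(pderiv ^^ n) (cprod m u v) = binsum n (\<lambda>s k. cprod (m + s) ((pderiv ^^ k) u) v)"
proof (induction n arbitrary: m u)
  case (Suc n)
  have "(pderiv ^^ Suc n) (cprod m u v) =
      (pderiv ^^ n) (cprod m (pderiv u) v) + (pderiv ^^ n) (cprod (Suc m) u v)"
    by (simp only: funpow_Suc_right comp_apply pderiv_cprod pderiv_pow_add)
  also have "\<dots> = binsum n (\<lambda>s k. cprod (m + s) ((pderiv ^^ Suc k) u) v) +
      binsum n (\<lambda>s k. cprod (m + Suc s) ((pderiv ^^ k) u) v)"
    by (simp only: Suc.IH funpow_Suc_right comp_apply add_Suc add_Suc_right)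
  finally show ?case
    by (simp only: binsum_Suc binsum_add)
qed simp

lemma lmul_binsum: "lmul a (binsum n h) = binsum n (\<lambda>s k. lmul a (h s k))"
proof -
  have "lmul a (sum f A) = (\<Sum>i\<in>A. lmul a (f i))" for f and A :: "nat set"
    by (induction A rule: infinite_finite_induct) (auto simp: lmul_add_right)
  then show ?thesis
    by (simp add: binsum_def lmul_of_nat)
qed

text \<open>By induction on the left factor: a constant reduces the claim to
  \<open>pderiv_pow_cprod\<close>, and the term with D is matched by
  \<open>binsum_absorb\<close>.\<close>

lemma cprod_assoc:
  "cprod n u (cprod m v w) = binsum n (\<lambda>s k. cprod (m + s) (cprod k u v) w)"
proof (induction u arbitrary: n)
  case (pCons a u)
  have minus: "cprod k (x - y) w = cprod k x w - cprod k y w" for k x y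
    using cprod_add_left[of k "x - y" y w] by simp
  have "cprod n (pCons a u) (cprod m v w) =
      lmul a ((pderiv ^^ n) (cprod m v w)) - of_nat n * cprod (n - 1) u (cprod m v w)"
    by (rule cprod_pCons_left)
  also have "\<dots> = binsum n (\<lambda>s k. cprod (m + s) (lmul a ((pderiv ^^ k) v)) w) -
      binsum n (\<lambda>s k. of_nat k * cprod (m + s) (cprod (k - 1) u v) w)"
    unfolding pderiv_pow_cprod lmul_binsum cprod_lmul_left pCons.IH binsum_absorb ..
  also have "\<dots> = binsum n (\<lambda>s k. cprod (m + s) (cprod k (pCons a u) v) w)"
    unfolding cprod_pCons_left minus cprod_of_nat_left
    by (simp add: binsum_def right_diff_distrib sum_subtractf)
  finally show ?case .
qed (simp add: binsum_def)

sublocale current: assoc_conformal_algebra scl cprod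
proof
  fix n m a b c and r :: 'k
  show "cprod n (a + b) c = cprod n a c + cprod n b c"
    by (rule cprod_add_left)
  show "cprod n a (b + c) = cprod n a b + cprod n a c"
    by (rule cprod_add_right)
  show "cprod n (scl [:r:] a) b = scl [:r:] (cprod n a b)"
    by (simp only: scl_const cprod_smult_left)
  show "cprod n a (scl [:r:] b) = scl [:r:] (cprod n a b)"
    by (simp only: scl_const cprod_smult_right)
  have "{n. cprod n a b \<noteq> 0} \<subseteq> {..degree a + degree b}"
    using cprod_eq_0[of a b] by (auto simp: not_less[symmetric])
  then show "finite {n. cprod n a b \<noteq> 0}"
    by (rule finite_subset) simp
  show "cprod n (scl [:0, 1:] a) b = - scl (of_nat n) (cprod (n - 1) a b)"
    by (simp only: scl_D scl_of_nat cprod_shift_left)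
  show "cprod n a (scl [:0, 1:] b) = scl [:0, 1:] (cprod n a b) + scl (of_nat n) (cprod (n - 1) a b)"
    by (simp only: scl_D scl_of_nat cprod_shift_right)
  show "cprod n a (cprod m b c) =
      (\<Sum>s\<le>n. scl (of_nat (n choose s)) (cprod (m + s) (cprod (n - s) a b) c))"
    by (simp only: cprod_assoc binsum_def scl_of_nat)
qed

section \<open>Unit and generators of the current algebra\<close>

lemma cprod_one_left: "cprod n [:one:] u = (pderiv ^^ n) u"
  by (rule poly_eqI) (simp add: cprod_const_left mul_one_left)

text \<open>With a constant right factor only \<open>u(-\<lambda>)\<close> depends on
  \<open>\<lambda>\<close>, and its coefficient of \<open>\<lambda>^n / n!\<close> is read
  off.\<close>

lemma cprod_one_right: "cprod n u [:one:] = (-1) ^ n * of_nat (fact n) * [:coeff u n:]"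
proof (induction u arbitrary: n)
  case (pCons a u)
  show ?case
  proof (cases n)
    case 0
    then show ?thesis
      by (simp add: cprod_pCons_left lmul_const mul_one_right)
  next
    case (Suc m)
    have "cprod n (pCons a u) [:one:] = - (of_nat (Suc m) * cprod m u [:one:])"
      by (simp only: Suc cprod_pCons_left pderiv_pow_const) simp
    then show ?thesis
      unfolding pCons.IH Suc fact_Suc of_nat_mult coeff_pCons_Suc power_Suc
      by (simp only: mult_minus_left mult_minus_right mult_1 of_nat_id ac_simps)
  qed
qed simp

lemma two_sided_unit_one: "current.two_sided_unit [:one:]"
proof -
  have "current.loc [:one:] [:one:] = 1"
    unfolding current.loc_def
  proof (rule Least_equality)
    show "\<forall>n\<ge>1. cprod n [:one:] [:one:] = 0"
      by (simp add: cprod_one_left pderiv_pow_const)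
    fix N assume "\<forall>n\<ge>N. cprod n [:one:] [:one:] = 0"
    moreover have "cprod 0 [:one:] [:one:] \<noteq> 0"
      by (simp add: cprod_one_left one_nonzero)
    ultimately show "1 \<le> N"
      by (cases N) auto
  qed
  moreover have "current.curly 0 u [:one:] = u" for u
  proof -
    \<comment> \<open>The weights in \<open>curly\<close> cancel the sign and the factorial of
      \<open>cprod_one_right\<close>, and \<open>D^s\<close> puts the coefficient back in its
      place.\<close>
    have eq: "scl (monom ((-1) ^ s / fact s) s) (cprod s u [:one:]) = monom (coeff u s) s" for s
    proof -
      have pm: "(-1) ^ s * of_nat (fact s) * [:coeff u s:] = smult [:(-1) ^ s * of_nat (fact s):] [:coeff u s:]"
      proof -
        have "(-1) ^ s * of_nat (fact s) = [:[:(-1) ^ s * of_nat (fact s) :: 'k:]:]"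
          by (cases "even s") (simp_all add: of_nat_poly)
        then show ?thesis by (simp del: of_nat_fact)
      qed
      have "monom [:(-1) ^ s / fact s :: 'k:] s = smult [:(-1) ^ s / fact s:] (monom 1 s)"
        by (simp add: smult_monom)
      then show ?thesis
        unfolding cprod_one_right scl_monom pm
        by (simp add: smult_monom flip: power_mult_distrib)
    qed
    have "cprod s u [:one:] \<noteq> 0" if "coeff u s \<noteq> 0" for s
      using eq[of s] that by auto
    then have "finite {s. cprod s u [:one:] \<noteq> 0}" "{s. coeff u s \<noteq> 0} \<subseteq> {s. cprod s u [:one:] \<noteq> 0}"
      by (auto intro: current.nprod_locality)
    then have "(\<Sum>s\<in>{s. cprod s u [:one:] \<noteq> 0}. monom (coeff u s) s) = (\<Sum>s\<in>{s. coeff u s \<noteq> 0}. monom (coeff u s) s)"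
      by (intro sum.mono_neutral_right) auto
    also have "\<dots> = (\<Sum>s\<le>degree u. monom (coeff u s) s)"
      by (intro sum.mono_neutral_left) (auto intro: le_degree)
    also have "\<dots> = u"
      by (rule poly_as_sum_of_monoms)
    finally show ?thesis
      by (simp add: current.curly_def eq)
  qed
  ultimately show ?thesis
    by (simp add: current.two_sided_unit_def current.left_unit_def current.right_unit_def cprod_one_left)
qed

text \<open>Multiplication by \<open>xi\<close> shifts monomials by \<open>R\<close>, so the first
  \<open>R\<close> monomials yield everything that is constant in D; the action of D supplies the
  rest.\<close>

lemma finitely_generated: "current.finitely_generated"
proof -
  define V where "V = insert [:xi:] ((\<lambda>m. [:monom 1 m:]) ` {..<R})"
  have all: "u \<in> T" if T: "V \<subseteq> T" "current.subalgebra T" for T u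
  proof -
    have sub: "scl.subspace T" and prod: "\<And>n a b. a \<in> T \<Longrightarrow> b \<in> T \<Longrightarrow> cprod n a b \<in> T"
      using T(2) by (auto simp: current.subalgebra_def)
    have mono: "[:monom 1 m:] \<in> T" for m
    proof (induction m rule: less_induct)
      case (less m)
      show ?case
      proof (cases "m < R")
        case True
        then show ?thesis using T(1) by (auto simp: V_def)
      next
        case False
        have "[:monom 1 (m - R):] \<in> T"
          using False R_pos by (intro less.IH) auto
        then have "cprod 0 [:xi:] [:monom 1 (m - R):] \<in> T"
          using T(1) by (intro prod) (auto simp: V_def)
        then show ?thesis
          using False by (simp add: cprod_const_left lmul_const mul_xi)
      qed
    qed
    have const: "[:p:] \<in> T" for p
    proof -
      have "scl [:coeff p i:] [:monom 1 i:] \<in> T" for i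
        by (intro scl.subspace_scale[OF sub] mono)
      then have "(\<Sum>i\<le>degree p. scl [:coeff p i:] [:monom 1 i:]) \<in> T"
        by (rule scl.subspace_sum[OF sub])
      moreover have "(\<Sum>i\<in>A. scl [:coeff p i:] [:monom 1 i:]) = [:\<Sum>i\<in>A. monom (coeff p i) i:]" for A
        by (induction A rule: infinite_finite_induct) (auto simp: scl_const smult_monom)
      ultimately show ?thesis
        by (simp add: poly_as_sum_of_monoms)
    qed
    show ?thesis
    proof (induction u)
      case 0
      show ?case by (rule scl.subspace_0[OF sub])
    next
      case (pCons a u)
      then show ?case
        unfolding pCons_eq_scl[of a u]
        by (intro scl.subspace_add[OF sub] scl.subspace_scale[OF sub] const)
    qed
  qed
  have "current.generates V"
    unfolding current.generates_def hull_def using all by auto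
  moreover have "finite V"
    by (simp add: V_def)
  ultimately show ?thesis
    by (auto simp: current.finitely_generated_def)
qed


section \<open>Filtration by degree and growth\<close>

definition gdeg :: "nat \<Rightarrow> 'k poly poly \<Rightarrow> bool" where
  "gdeg d u \<longleftrightarrow> (\<forall>i. degree (coeff u i) < Suc d * R)"

lemma gdeg_0: "gdeg d 0"
  using R_pos by (simp add: gdeg_def)

lemma gdeg_add: "gdeg d u \<Longrightarrow> gdeg d v \<Longrightarrow> gdeg d (u + v)"
  by (auto simp: gdeg_def intro: degree_add_less)

lemma gdeg_smult_const: "gdeg d u \<Longrightarrow> gdeg d (smult [:r:] u)"
  unfolding gdeg_def using R_pos by (auto simp: degree_smult_eq)

lemma gdeg_scl: "gdeg d u \<Longrightarrow> gdeg d (scl h u)"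
proof (induction h)
  case (pCons r h)
  have "scl (pCons r h) u = smult [:r:] u + pCons 0 (scl h u)"
    by (simp add: scl_def map_poly_pCons)
  moreover have "gdeg d (pCons 0 (scl h u))"
    using pCons R_pos by (auto simp: gdeg_def coeff_pCons split: nat.splits)
  ultimately show ?case
    using pCons by (auto intro: gdeg_add gdeg_smult_const)
qed (simp add: gdeg_0)

text \<open>Degrees in D are left free, which makes this an H-submodule; the
  \<open>Suc d * R\<close> lowest monomials of the inner variable form a basis.\<close>

lemma subspace_gdeg: "scl.subspace (Collect (gdeg d))"
  by (rule scl.subspaceI) (auto simp: gdeg_0 gdeg_add gdeg_scl)

lemma gdeg_mono: "gdeg d u \<Longrightarrow> d \<le> e \<Longrightarrow> gdeg e u"
  unfolding gdeg_def by (meson less_le_trans mult_le_mono1 Suc_le_mono)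

lemma gdeg_pderiv_pow: "gdeg d u \<Longrightarrow> gdeg d ((pderiv ^^ n) u)"
proof (induction n)
  case (Suc n)
  have "degree (of_nat k * p) \<le> degree p" for k and p :: "'k poly"
    by (metis degree_smult_le mult_1 mult_smult_left of_nat_poly smult_one)
  then have "gdeg d (pderiv v)" if "gdeg d v" for v
    using that unfolding gdeg_def coeff_pderiv by (metis le_less_trans)
  then show ?case using Suc by simp
qed simp

lemma gdeg_cprod: "gdeg d u \<Longrightarrow> gdeg e v \<Longrightarrow> gdeg (d + e) (cprod n u v)"
proof (induction u arbitrary: n)
  case (pCons a u)
  have a: "degree a < Suc d * R" and u: "gdeg d u"
    using pCons.prems(1) unfolding gdeg_def by (metis coeff_pCons_0, metis coeff_pCons_Suc)
  have "gdeg (d + e) (lmul a ((pderiv ^^ n) v))"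
    using a gdeg_pderiv_pow[OF pCons.prems(2)] unfolding gdeg_def coeff_lmul
    by (blast intro: degree_mul)
  moreover have "gdeg (d + e) (scl (- of_nat n) (cprod (n - 1) u v))"
    by (intro gdeg_scl pCons.IH u pCons.prems)
  moreover have eq: "cprod n (pCons a u) v =
      lmul a ((pderiv ^^ n) v) + scl (- of_nat n) (cprod (n - 1) u v)"
    by (simp add: cprod_pCons_left scl_of_nat)
  ultimately show ?case
    by (simp only: eq gdeg_add)
qed (simp add: gdeg_0)

end

text \<open>By Gaussian elimination on the last coordinate.\<close>

lemma exists_nontrivial_relation:
  fixes v :: "'i \<Rightarrow> nat \<Rightarrow> 'a::idom"
  assumes "finite I" "m < card I"
  shows "\<exists>c. (\<exists>i\<in>I. c i \<noteq> 0) \<and> (\<forall>j<m. (\<Sum>i\<in>I. c i * v i j) = 0)"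
  using assms
proof (induction m arbitrary: I v)
  case 0
  then obtain i where "i \<in> I" by fastforce
  then show ?case by (intro exI[of _ "\<lambda>_. 1"]) auto
next
  case (Suc m)
  show ?case
  proof (cases "\<forall>i\<in>I. v i m = 0")
    case True
    obtain c where "\<exists>i\<in>I. c i \<noteq> 0" "\<forall>j<m. (\<Sum>i\<in>I. c i * v i j) = 0"
      using Suc.IH[of I v] Suc.prems by auto
    then show ?thesis
      using True by (intro exI[of _ c]) (auto simp: less_Suc_eq)
  next
    case False
    then obtain k where k: "k \<in> I" "v k m \<noteq> 0" by auto
    \<comment> \<open>Cross-multiplication with the pivot \<open>v k m\<close> replaces division,
      which an integral domain does not offer.\<close>
    define w where "w i j = v k m * v i j - v i m * v k j" for i j
    have "m < card (I - {k})"
      using k Suc.prems by simp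
    then obtain c where c: "\<exists>i\<in>I - {k}. c i \<noteq> 0" "\<forall>j<m. (\<Sum>i\<in>I - {k}. c i * w i j) = 0"
      using Suc.IH[of "I - {k}" w] Suc.prems(1) by auto
    \<comment> \<open>The coefficient at the pivot collects the subtracted multiples of
      \<open>v k\<close>, so that the relation among the \<open>w i\<close> becomes one among the
      \<open>v i\<close>.\<close>
    define c' where "c' i = (if i = k then - (\<Sum>i\<in>I - {k}. c i * v i m) else c i * v k m)" for i
    have "(\<Sum>i\<in>I. c' i * v i j) = (\<Sum>i\<in>I - {k}. c i * w i j)" for j
    proof -
      have "(\<Sum>i\<in>I. c' i * v i j) = c' k * v k j + (\<Sum>i\<in>I - {k}. c' i * v i j)"
        by (rule sum.remove[OF Suc.prems(1) k(1)])
      also have "\<dots> = (\<Sum>i\<in>I - {k}. c i * w i j)"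
        by (simp add: c'_def w_def sum_distrib_left sum_distrib_right sum_subtractf algebra_simps)
      finally show ?thesis .
    qed
    moreover have "w i m = 0" for i
      by (simp add: w_def)
    moreover have "\<exists>i\<in>I. c' i \<noteq> 0"
      using c(1) k by (auto simp: c'_def)
    ultimately show ?thesis
      using c(2) by (intro exI[of _ c']) (auto simp: less_Suc_eq)
  qed
qed

context poly_algebra
begin

text \<open>Seen as vectors over H with coordinates \<open>row u j\<close>, these elements have only
  the coordinates with \<open>j < Suc d * R\<close>, and more vectors than coordinates are
  dependent.\<close>

lemma card_independent_le:
  assumes "B \<subseteq> Collect (gdeg d)" "finite B" "scl.independent B"
  shows "card B \<le> Suc d * R"
proof (rule ccontr)
  define row where "row u j = map_poly (\<lambda>a. coeff a j) u" for u :: "'k poly poly" and j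
  have coeff_row: "coeff (row u j) n = coeff (coeff u n) j" for u j n
    by (simp add: row_def coeff_map_poly)
  have row_add: "row (u + v) j = row u j + row v j" for u v j
    by (rule poly_eqI) (simp add: coeff_row)
  have row_scl: "row (scl h u) j = h * row u j" for h u j
    by (rule poly_eqI) (simp add: coeff_row scl_def coeff_mult coeff_map_poly coeff_sum)
  have row_sum: "row (\<Sum>u\<in>A. scl (c u) u) j = (\<Sum>u\<in>A. c u * row u j)" for c A j
  proof (induction A rule: infinite_finite_induct)
    case (insert x A)
    then show ?case by (simp add: row_add row_scl)
  qed (auto intro: poly_eqI simp: coeff_row)
  assume "\<not> card B \<le> Suc d * R"
  then obtain c where c: "\<exists>u\<in>B. c u \<noteq> 0" "\<forall>j<Suc d * R. (\<Sum>u\<in>B. c u * row u j) = 0"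
    using exists_nontrivial_relation[of B "Suc d * R" row] assms(2) by auto
  have "gdeg d (\<Sum>u\<in>B. scl (c u) u)"
  proof -
    have "scl (c u) u \<in> Collect (gdeg d)" if "u \<in> B" for u
      using that assms(1) by (auto intro: gdeg_scl)
    then have "(\<Sum>u\<in>B. scl (c u) u) \<in> Collect (gdeg d)"
      by (rule scl.subspace_sum[OF subspace_gdeg])
    then show ?thesis by simp
  qed
  have "(\<Sum>u\<in>B. scl (c u) u) = 0" (is "?w = 0")
  proof (rule poly_eqI, rule poly_eqI)
    fix n j
    show "coeff (coeff ?w n) j = coeff (coeff 0 n) j"
    proof (cases "j < Suc d * R")
      case True
      then have "row ?w j = 0"
        using c(2) by (simp add: row_sum)
      then show ?thesis
        using coeff_row[of ?w j n] by simp
    next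
      case False
      then have "degree (coeff ?w n) < j"
        using \<open>gdeg d ?w\<close> unfolding gdeg_def by (meson less_le_trans not_less)
      then show ?thesis
        by (simp add: coeff_eq_0)
    qed
  qed
  then show False
    using scl.independentD[OF assms(3,2) order_refl] c(1) by blast
qed

text \<open>Monomials of length \<open>l\<close> in elements of \<open>gdeg K\<close> lie in
  \<open>gdeg (K * l)\<close>, so the ranks grow at most linearly, and a constant factor does not
  affect the limit.\<close>

lemma growth_exponent_le_1:
  assumes "finite V"
  shows "current.growth_exponent V \<le> 1"
proof -
  obtain K where K: "\<And>v. v \<in> V \<Longrightarrow> gdeg K v"
  proof -
    have "\<exists>d. gdeg d v" for v
    proof (intro exI)
      have "degree (coeff v i) \<le> Max ((\<lambda>i. degree (coeff v i)) ` {..degree v})" for i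
        by (cases "i \<le> degree v") (auto simp: coeff_eq_0)
      moreover have "d < Suc d * R" for d
        using R_pos by (cases R) auto
      ultimately show "gdeg (Max ((\<lambda>i. degree (coeff v i)) ` {..degree v})) v"
        unfolding gdeg_def by (blast intro: le_less_trans)
    qed
    then have "\<forall>v. \<exists>d. gdeg d v" ..
    from choice[OF this] obtain d where d: "\<forall>v. gdeg (d v) v" ..
    have "gdeg (Max (d ` V)) v" if "v \<in> V" for v
      using assms that by (intro gdeg_mono[OF d[rule_format]]) auto
    then show ?thesis by (rule that)
  qed
  have monomial: "gdeg (K * l) a" if "current.monomial V l a" for l a
    using that
  proof induction
    case (monomial_nprod l a m b n)
    then show ?case
      using gdeg_cprod[of "K * l" a "K * m" b n] by (simp add: distrib_left)
  qed (simp add: K)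
  have rank: "current.rank (current.filtration V n) \<le> Suc (K * n) * R" for n
  proof -
    have "current.filtration V n \<subseteq> Collect (gdeg (K * n))"
      unfolding current.filtration_def
    proof (rule scl.span_minimal[OF _ subspace_gdeg], safe)
      fix a l assume "l \<le> n" "current.monomial V l a"
      then show "gdeg (K * n) a"
        by (intro gdeg_mono[OF monomial]) auto
    qed
    then have "card B \<le> Suc (K * n) * R"
      if "B \<subseteq> current.filtration V n" "finite B" "scl.independent B" for B
      using that by (intro card_independent_le) auto
    moreover have "scl.independent {}"
      by (rule scl.independent_empty)
    ultimately show ?thesis
      unfolding current.rank_def by (intro cSup_least) blast+
  qed
  define c where "c = real (Suc K * R)"
  have c: "c \<ge> 1"
    using R_pos unfolding c_def by (cases R) auto
  have "current.growth_exponent V \<le> limsup (\<lambda>n. ereal (ln (c * real n) / ln (real n)))"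
    unfolding current.growth_exponent_def
  proof (rule Limsup_mono, rule eventually_sequentiallyI)
    fix n :: nat assume n: "2 \<le> n"
    let ?r = "current.rank (current.filtration V n)"
    have "Suc (K * n) * R \<le> Suc K * R * n"
      using n by (simp add: algebra_simps)
    then have "real ?r \<le> c * real n"
      unfolding c_def using rank[of n] by (metis le_trans of_nat_le_iff of_nat_mult)
    \<comment> \<open>For rank 0 the quantity to be bounded is \<open>ln 0 = 0\<close>, so the bound
      has to be nonnegative.\<close>
    moreover have "1 * 1 \<le> c * real n"
      using c n by (intro mult_mono) auto
    ultimately have "ln (real ?r) \<le> ln (c * real n)"
      by (cases "?r = 0") auto
    then show "ereal (ln (real ?r) / ln (real n)) \<le> ereal (ln (c * real n) / ln (real n))"
      using n by (simp add: divide_right_mono)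
  qed
  also have "(\<lambda>n. ln (c * real n) / ln (real n)) \<longlonglongrightarrow> 1"
    using c by real_asymp
  then have "limsup (\<lambda>n. ereal (ln (c * real n) / ln (real n))) = 1"
    by (intro lim_imp_Limsup) (auto simp: one_ereal_def)
  finally show ?thesis .
qed

text \<open>The set chosen in \<open>gk_dim\<close> is finite because some finite generating set
  exists, and the growth bound holds for every finite set.\<close>

lemma gk_dim_le_1: "current.gk_dim \<le> 1"
proof -
  have "finite (SOME V. finite V \<and> current.generates V)"
    using finitely_generated someI_ex[of "\<lambda>V. finite V \<and> current.generates V"]
    by (auto simp: current.finitely_generated_def)
  then show ?thesis
    unfolding current.gk_dim_def by (rule growth_exponent_le_1)
qed

end

section \<open>Matrices over a polynomial ring\<close>

locale matrix_poly =
  fixes r :: nat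
  assumes r_pos: "r > 0"
begin

text \<open>A polynomial encodes an \<open>r \<times> r\<close> matrix over \<open>k[x]\<close>: the coefficient with index
  \<open>(q r + i) r + j\<close>, where \<open>i, j < r\<close>, is the coefficient of \<open>x\<^sup>q\<close> in the entry \<open>(i, j)\<close>.\<close>

definition dec :: "'k::field_char_0 poly \<Rightarrow> nat \<Rightarrow> nat \<Rightarrow> 'k poly" where
  "dec p i j = Abs_poly (\<lambda>q. coeff p ((q * r + i) * r + j))"

definition enc :: "(nat \<Rightarrow> nat \<Rightarrow> 'k::field_char_0 poly) \<Rightarrow> 'k poly" where
  "enc a = Abs_poly (\<lambda>m. coeff (a (m div r mod r) (m mod r)) (m div r div r))"

lemma coeff_dec: "coeff (dec p i j) q = coeff p ((q * r + i) * r + j)"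
proof -
  \<comment> \<open>Hence the coefficients vanish for \<open>q\<close> beyond
    \<open>degree p\<close>, as \<open>Abs_poly\<close> requires.\<close>
  have "q \<le> (q * r + i) * r + j" for q
    using r_pos by (cases r) (auto simp: algebra_simps)
  then have "coeff p ((q * r + i) * r + j) = 0" if "degree p < q" for q
    using that by (intro coeff_eq_0) (rule less_le_trans)
  then show ?thesis
    unfolding dec_def by (subst coeff_Abs_poly[where n = "degree p"]) auto
qed

lemma coeff_enc: "coeff (enc a) m = coeff (a (m div r mod r) (m mod r)) (m div r div r)"
proof -
  \<comment> \<open>The sum serves as a common bound for the degrees of all entries.\<close>
  define N where "N = (\<Sum>i<r. \<Sum>j<r. degree (a i j))"
  have N: "degree (a i j) \<le> N" if "i < r" "j < r" for i j
  proof -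
    have "degree (a i j) \<le> (\<Sum>j<r. degree (a i j))"
      using that by (intro member_le_sum) auto
    also have "\<dots> \<le> N"
      unfolding N_def using that by (intro member_le_sum[where f = "\<lambda>i. \<Sum>j<r. degree (a i j)"]) auto
    finally show ?thesis .
  qed
  have "coeff (a (m div r mod r) (m mod r)) (m div r div r) = 0" if "Suc N * r * r < m" for m
  proof (rule coeff_eq_0)
    have "Suc N * r * r div r div r \<le> m div r div r"
      using that by (intro div_le_mono) auto
    then have "N < m div r div r"
      using r_pos by simp
    then show "degree (a (m div r mod r) (m mod r)) < m div r div r"
      using N[of "m div r mod r" "m mod r"] r_pos by simp
  qed
  then show ?thesis
    unfolding enc_def by (subst coeff_Abs_poly[where n = "Suc N * r * r"]) auto
qed

lemma dec_enc: "i < r \<Longrightarrow> j < r \<Longrightarrow> dec (enc a) i j = a i j"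
  by (rule poly_eqI) (simp add: coeff_dec coeff_enc)

lemma coeff_eq_coeff_dec: "coeff p m = coeff (dec p (m div r mod r) (m mod r)) (m div r div r)"
  by (simp add: coeff_dec)

lemma dec_eqI:
  assumes "\<And>i j. i < r \<Longrightarrow> j < r \<Longrightarrow> dec p i j = dec q i j"
  shows "p = q"
proof (rule poly_eqI)
  fix m
  show "coeff p m = coeff q m"
    using assms[of "m div r mod r" "m mod r"] r_pos by (simp add: coeff_eq_coeff_dec[of _ m])
qed

lemma dec_0 [simp]: "dec 0 i j = 0"
  by (rule poly_eqI) (simp add: coeff_dec)

lemma dec_add: "dec (p + q) i j = dec p i j + dec q i j"
  by (rule poly_eqI) (simp add: coeff_dec)

lemma dec_smult: "dec (smult c p) i j = smult c (dec p i j)"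
  by (rule poly_eqI) (simp add: coeff_dec)

text \<open>The coefficients of \<open>x^q\<close> occupy exactly the indices from
  \<open>q r^2\<close> to \<open>(q + 1) r^2 - 1\<close>. The filtration required in
  \<open>poly_algebra\<close> thus becomes the one by degrees of entries, which is compatible with
  matrix products.\<close>

lemma degree_iff:
  "degree p < Suc d * (r * r) \<longleftrightarrow> (\<forall>i<r. \<forall>j<r. degree (dec p i j) \<le> d)" (is "?l \<longleftrightarrow> ?r")
proof
  assume ?l
  have "coeff (dec p i j) q = 0" if "d < q" for i j q
  proof -
    have "Suc d * (r * r) \<le> q * (r * r)"
      using that by (intro mult_le_mono1) auto
    also have "\<dots> \<le> (q * r + i) * r + j"
      by (simp add: algebra_simps)
    finally show ?thesis
      using \<open>?l\<close> unfolding coeff_dec by (intro coeff_eq_0) auto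
  qed
  then show ?r
    by (auto intro: degree_le)
next
  assume ?r
  let ?m = "degree p"
  show ?l
  proof (cases "p = 0")
    case False
    then have "coeff (dec p (?m div r mod r) (?m mod r)) (?m div r div r) \<noteq> 0"
      unfolding coeff_eq_coeff_dec[symmetric] by simp
    then have "?m div r div r \<le> d"
      using \<open>?r\<close> r_pos by (meson le_degree le_trans mod_less_divisor)
    then have "?m div (r * r) < Suc d"
      by (simp add: div_mult2_eq)
    then show ?thesis
      using r_pos by (simp add: div_less_iff_less_mult)
  qed (use r_pos in simp)
qed

definition mmul :: "'k::field_char_0 poly \<Rightarrow> 'k poly \<Rightarrow> 'k poly" where
  "mmul p q = enc (\<lambda>i j. \<Sum>k<r. dec p i k * dec q k j)"

lemma dec_mmul: "i < r \<Longrightarrow> j < r \<Longrightarrow> dec (mmul p q) i j = (\<Sum>k<r. dec p i k * dec q k j)"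
  by (simp add: mmul_def dec_enc)

definition scalar_matrix :: "'k::field_char_0 poly \<Rightarrow> 'k poly" where
  "scalar_matrix x = enc (\<lambda>i j. if i = j then x else 0)"

lemma dec_scalar_mmul: "i < r \<Longrightarrow> j < r \<Longrightarrow> dec (mmul (scalar_matrix x) p) i j = x * dec p i j"
  by (simp add: dec_mmul scalar_matrix_def dec_enc if_distrib[of "\<lambda>y. y * _"] sum.delta cong: if_cong)

lemma dec_mmul_scalar: "i < r \<Longrightarrow> j < r \<Longrightarrow> dec (mmul p (scalar_matrix x)) i j = dec p i j * x"
  by (simp add: dec_mmul scalar_matrix_def dec_enc if_distrib[of "\<lambda>y. _ * y"] sum.delta cong: if_cong)

lemma poly_algebra_mmul:
  "poly_algebra (mmul :: 'k::field_char_0 poly \<Rightarrow> _) (scalar_matrix 1) (scalar_matrix (monom 1 1)) (r * r)"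
proof
  fix a b c :: "'k poly" and s :: 'k and d e m :: nat
  show "mmul (a + b) c = mmul a c + mmul b c"
    by (rule dec_eqI) (simp add: dec_mmul dec_add distrib_right sum.distrib)
  show "mmul a (b + c) = mmul a b + mmul a c"
    by (rule dec_eqI) (simp add: dec_mmul dec_add distrib_left sum.distrib)
  show "mmul (smult s a) b = smult s (mmul a b)"
    by (rule dec_eqI) (simp add: dec_mmul dec_smult smult_sum_right)
  show "mmul a (smult s b) = smult s (mmul a b)"
    by (rule dec_eqI) (simp add: dec_mmul dec_smult smult_sum_right)
  show "mmul (mmul a b) c = mmul a (mmul b c)"
  proof (rule dec_eqI)
    fix i j assume "i < r" "j < r"
    then have "dec (mmul (mmul a b) c) i j = (\<Sum>l<r. \<Sum>k<r. dec a i k * dec b k l * dec c l j)"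
      by (simp add: dec_mmul sum_distrib_right)
    also have "\<dots> = (\<Sum>k<r. \<Sum>l<r. dec a i k * dec b k l * dec c l j)"
      by (rule sum.swap)
    also have "\<dots> = dec (mmul a (mmul b c)) i j"
      using \<open>i < r\<close> \<open>j < r\<close> by (simp add: dec_mmul sum_distrib_left mult.assoc)
    finally show "dec (mmul (mmul a b) c) i j = dec (mmul a (mmul b c)) i j" .
  qed
  show "mmul (scalar_matrix 1) a = a"
    by (rule dec_eqI) (simp add: dec_scalar_mmul)
  show "mmul a (scalar_matrix 1) = a"
    by (rule dec_eqI) (simp add: dec_mmul_scalar)
  have "dec (scalar_matrix 1 :: 'k poly) 0 0 = 1"
    using r_pos by (simp add: scalar_matrix_def dec_enc)
  then show "scalar_matrix 1 \<noteq> (0 :: 'k poly)"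
    by auto
  show "r * r > 0"
    using r_pos by simp
  show "degree (mmul a b) < Suc (d + e) * (r * r)"
    if "degree a < Suc d * (r * r)" "degree b < Suc e * (r * r)"
    using that unfolding degree_iff
    by (auto simp: dec_mmul intro!: degree_sum_le order.trans[OF degree_mult_le] add_mono)
  show "mmul (scalar_matrix (monom 1 1)) (monom 1 m) = (monom 1 (m + r * r) :: 'k poly)"
  proof (rule dec_eqI)
    fix i j assume ij: "i < r" "j < r"
    have "dec (monom 1 (m + r * r)) i j = monom 1 1 * dec (monom 1 m :: 'k poly) i j"
    proof (rule poly_eqI)
      fix q
      \<comment> \<open>Multiplication by \<open>x\<close> shifts indices by \<open>r * r\<close>;
        constant coefficients of entries have indices below that shift, where the shifted monomial
        has coefficient 0.\<close>
      have "(0 * r + i) * r + j < r * r"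
      proof -
        have "Suc i * r \<le> r * r"
          using ij by (intro mult_le_mono1) auto
        then show ?thesis using ij by simp
      qed
      then show "coeff (dec (monom 1 (m + r * r)) i j) q = coeff (monom 1 1 * dec (monom 1 m :: 'k poly) i j) q"
        by (cases q) (auto simp: coeff_dec coeff_monom_mult algebra_simps)
    qed
    then show "dec (mmul (scalar_matrix (monom 1 1)) (monom 1 m)) i j = dec (monom 1 (m + r * r) :: 'k poly) i j"
      using ij by (simp add: dec_scalar_mmul)
  qed
qed

definition const_matrix :: "(nat \<Rightarrow> nat \<Rightarrow> 'k::field_char_0) \<Rightarrow> 'k poly" where
  "const_matrix A = enc (\<lambda>i j. [:A i j:])"

lemma dec_const_matrix: "i < r \<Longrightarrow> j < r \<Longrightarrow> dec (const_matrix A) i j = [:A i j:]"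
  by (simp add: const_matrix_def dec_enc)

lemma mmul_const_matrix:
  "mmul (const_matrix A) (const_matrix B) = const_matrix (\<lambda>i j. \<Sum>k<r. A i k * B k j)"
proof (rule dec_eqI)
  fix i j assume ij: "i < r" "j < r"
  show "dec (mmul (const_matrix A) (const_matrix B)) i j =
      dec (const_matrix (\<lambda>i j. \<Sum>k<r. A i k * B k j)) i j"
    using ij by (simp add: dec_mmul dec_const_matrix const_poly_sum mult.commute)
qed

lemma const_matrix_binsum:
  "const_matrix (\<lambda>i j. binsum n (\<lambda>s k. F s k i j)) = binsum n (\<lambda>s k. const_matrix (F s k))"
proof (rule dec_eqI)
  fix i j assume ij: "i < r" "j < r"
  have dec_sum: "dec (sum f S) i j = (\<Sum>k\<in>S. dec (f k) i j)" for f :: "nat \<Rightarrow> 'a poly" and S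
    by (induction S rule: infinite_finite_induct) (auto simp: dec_add)
  have dec_of_nat: "dec (of_nat c * p) i j = of_nat c * dec p i j" for c and p :: "'a poly"
    using dec_smult[of "of_nat c" p i j] by (simp add: of_nat_poly)
  have const: "[:of_nat c * a:] = of_nat c * [:a:]" for c and a :: 'a
    by (simp add: of_nat_poly)
  show "dec (const_matrix (\<lambda>i j. binsum n (\<lambda>s k. F s k i j))) i j =
      dec (binsum n (\<lambda>s k. const_matrix (F s k))) i j"
    by (simp only: dec_const_matrix[OF ij] binsum_def dec_sum dec_of_nat const_poly_sum const)
qed

lemma const_matrix_cong:
  "(\<And>i j. i < r \<Longrightarrow> j < r \<Longrightarrow> A i j = B i j) \<Longrightarrow> const_matrix A = const_matrix B"
  by (rule dec_eqI) (simp add: dec_const_matrix)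

lemma const_matrix_eq_0_iff: "const_matrix A = 0 \<longleftrightarrow> (\<forall>i<r. \<forall>j<r. A i j = 0)"
proof
  assume "const_matrix A = 0"
  then have "[:A i j:] = 0" if "i < r" "j < r" for i j
    using dec_const_matrix[OF that, of A] by simp
  then show "\<forall>i<r. \<forall>j<r. A i j = 0"
    by simp
qed (auto intro: dec_eqI simp: dec_const_matrix)

lemma const_matrix_add: "const_matrix (\<lambda>i j. A i j + B i j) = const_matrix A + const_matrix B"
  by (rule dec_eqI) (simp add: dec_const_matrix dec_add)

lemma const_matrix_smult: "const_matrix (\<lambda>i j. c * A i j) = smult c (const_matrix A)"
  by (rule dec_eqI) (simp add: dec_const_matrix dec_smult)

end

section \<open>Homomorphisms into current algebras\<close>

lemma (in conformal_algebra) scale_pCons: "scale (pCons r h) c = scale [:r:] c + scale [:0, 1:] (scale h c)"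
proof -
  have "pCons r h = [:r:] + [:0, 1:] * h" by simp
  then show ?thesis by (metis scale_left_distrib scale_scale)
qed

context poly_algebra
begin

text \<open>\<open>\<tau> c m\<close> is the image of the symbol \<open>c(m)\<close> of the coefficient algebra, and the embedding sends
  \<open>c\<close> to the sum of all \<open>(-D)\<^sup>m / m!\<close> times \<open>\<tau> c m\<close>.\<close>

lemma embedding:
  fixes scale :: "'k poly \<Rightarrow> 'c::ab_group_add \<Rightarrow> 'c"
  assumes C: "assoc_conformal_algebra scale nprod"
    and add: "\<And>c d m. \<tau> (c + d) m = \<tau> c m + \<tau> d m"
    and const: "\<And>r c m. \<tau> (scale [:r:] c) m = smult r (\<tau> c m)"
    and D: "\<And>c m. \<tau> (scale [:0, 1:] c) m = smult (- of_nat m) (\<tau> c (m - 1))"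
    and fin: "\<And>c. \<exists>M. \<forall>m\<ge>M. \<tau> c m = 0"
    and prod: "\<And>a b n m. mul (\<tau> a n) (\<tau> b m) = binsum n (\<lambda>s k. \<tau> (nprod k a b) (m + s))"
    and inj: "\<And>c. (\<And>m. \<tau> c m = 0) \<Longrightarrow> c = 0"
  shows "\<exists>f. conformal_hom scale nprod scl cprod f \<and> inj f"
proof -
  interpret C: assoc_conformal_algebra scale nprod by (rule C)
  \<comment> \<open>The image of \<open>c\<close> is \<open>g 0 c\<close>; up to sign,
    \<open>g s c\<close> is its \<open>s\<close>-th derivative.\<close>
  define g where "g s c = Abs_poly (\<lambda>m. smult ((-1) ^ m / fact m) (\<tau> c (m + s)))" for s c
  have coeff_g: "coeff (g s c) m = smult ((-1) ^ m / fact m) (\<tau> c (m + s))" for s c m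
  proof -
    obtain M where "\<forall>m\<ge>M. \<tau> c m = 0"
      using fin by blast
    then show ?thesis
      unfolding g_def by (subst coeff_Abs_poly[where n = M]) auto
  qed
  have g_add: "g 0 (c + d) = g 0 c + g 0 d" for c d
    by (rule poly_eqI) (simp add: coeff_g add smult_add_right)
  have g_const: "g 0 (scale [:r:] c) = scl [:r:] (g 0 c)" for r c
    by (rule poly_eqI) (simp add: coeff_g const scl_const mult.commute)
  have g_D: "g 0 (scale [:0, 1:] c) = scl [:0, 1:] (g 0 c)" for c
  proof (rule poly_eqI)
    fix m
    show "coeff (g 0 (scale [:0, 1:] c)) m = coeff (scl [:0, 1:] (g 0 c)) m"
    proof (cases m)
      case (Suc l)
      have "(-1) ^ Suc l / fact (Suc l) * - of_nat (Suc l) = ((-1) ^ l / fact l :: 'k)"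
        by (simp add: field_simps del: of_nat_Suc)
      then show ?thesis
        by (simp only: coeff_g D scl_D Suc coeff_pCons_Suc smult_smult add_0_right diff_Suc_1)
    qed (simp add: coeff_g D scl_D)
  qed
  have g_0: "g 0 0 = 0"
    using g_add[of 0 0] by simp
  have g_scale: "g 0 (scale h c) = scl h (g 0 c)" for h c
  proof (induction h)
    case (pCons r h)
    then show ?case
      unfolding C.scale_pCons[of r h] current.scale_pCons[of r h] g_add g_const g_D by simp
  qed (simp add: g_0)
  have pderiv_g: "pderiv (g s c) = - g (Suc s) c" for s c
  proof (rule poly_eqI)
    fix m
    have "of_nat (Suc m) * p = smult (of_nat (Suc m)) p" for p :: "'k poly"
      by (simp add: of_nat_poly del: of_nat_Suc)
    moreover have "of_nat (Suc m) * ((-1) ^ Suc m / fact (Suc m)) = (- ((-1) ^ m / fact m) :: 'k)"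
      by (simp add: field_simps del: of_nat_Suc)
    ultimately show "coeff (pderiv (g s c)) m = coeff (- g (Suc s) c) m"
      by (simp only: coeff_pderiv coeff_g coeff_minus smult_smult smult_minus_left add_Suc add_Suc_right)
  qed
  have pderiv_pow_g: "(pderiv ^^ k) (g 0 c) = smult ((-1) ^ k) (g k c)" for k c
    by (induction k) (auto simp: pderiv_smult pderiv_g)
  have cprod_g: "cprod n (g 0 a) (g 0 b) = g 0 (nprod n a b)" for n a b
  proof (rule poly_eqI)
    fix j
    have int: "(-1) ^ i * of_nat N * u = smult [:(-1) ^ i * of_nat N:] u"
      for i N and u :: "'k poly poly"
      by (cases "even i") (simp_all add: of_nat_poly)
    \<comment> \<open>The factor \<open>(-1)^i i!\<close> in \<open>cprod\<close> cancels the weight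
      of the coefficient of \<open>g 0 a\<close>, leaving a binomial coefficient.\<close>
    have summand: "coeff ((-1) ^ i * of_nat (fact i * (n choose i)) * lmul (coeff (g 0 a) i)
        ((pderiv ^^ k) (g 0 b))) j =
      smult ((-1) ^ j / fact j) (of_nat (n choose i) * ((-1) ^ k * mul (\<tau> a i) (\<tau> b (j + k))))" for i k
    proof -
      have sign: "smult ((-1) ^ k) u = smult [:(-1) ^ k:] u" for u :: "'k poly poly"
      proof -
        have "[:-1 :: 'k:] = -1"
          by (metis minus_pCons minus_zero pCons_one)
        then show ?thesis
          by (cases "even k") (simp_all add: pCons_one)
      qed
      have "coeff ((-1) ^ i * of_nat (fact i * (n choose i)) * lmul (coeff (g 0 a) i)
          ((pderiv ^^ k) (g 0 b))) j =
        smult ((-1) ^ i * of_nat (fact i * (n choose i)) * ((-1) ^ i / fact i) * (-1) ^ k * ((-1) ^ j / fact j))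
          (mul (\<tau> a i) (\<tau> b (j + k)))"
        unfolding int pderiv_pow_g sign lmul_smult_right
        by (simp add: coeff_g mul_smult_left mul_smult_right mult_ac)
      also have "(-1) ^ i * of_nat (fact i * (n choose i)) * ((-1) ^ i / fact i) * (-1) ^ k * ((-1) ^ j / fact j) =
          ((-1) ^ j / fact j) * (of_nat (n choose i) * (-1) ^ k :: 'k)"
        by (simp flip: power_mult_distrib)
      also have "smult \<dots> p = smult ((-1) ^ j / fact j) (of_nat (n choose i) * ((-1) ^ k * p))" for p
        by (cases "even k") (simp_all add: of_nat_poly)
      finally show ?thesis .
    qed
    have "coeff (cprod n (g 0 a) (g 0 b)) j = smult ((-1) ^ j / fact j)
        (binsum n (\<lambda>i k. (-1) ^ k * mul (\<tau> a i) (\<tau> b (j + k))))"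
      unfolding cprod_def binsum_def coeff_sum summand smult_sum_right ..
    \<comment> \<open>Expanding the products by \<open>prod\<close> produces the umbral difference
      of \<open>binsum_inverse\<close>, of which only the \<open>n\<close>-product survives.\<close>
    also have "binsum n (\<lambda>i k. (-1) ^ k * mul (\<tau> a i) (\<tau> b (j + k))) = \<tau> (nprod n a b) (j + 0)"
      unfolding prod add.assoc by (rule binsum_inverse[where g = "\<lambda>l t. \<tau> (nprod l a b) (j + t)"])
    finally show "coeff (cprod n (g 0 a) (g 0 b)) j = coeff (g 0 (nprod n a b)) j"
      by (simp add: coeff_g)
  qed
  interpret f: conformal_hom scale nprod scl cprod "g 0"
    by unfold_locales (simp_all add: g_add g_scale cprod_g)
  have "inj (g 0)"
    unfolding f.inj_iff_eq_0
  proof (intro allI impI)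
    fix c assume "g 0 c = 0"
    then have "\<tau> c m = 0" for m
      using coeff_g[of 0 c m] by simp
    then show "c = 0" by (rule inj)
  qed
  then show ?thesis
    using f.conformal_hom_axioms by blast
qed

end

section \<open>Functionals on the coefficient algebra\<close>

text \<open>Restriction to \<open>Y\<close> is injective on \<open>U\<close> and lands in the span
  of finitely many indicator functions, so \<open>U\<close> has a finite basis;
  \<open>\<rho>\<close> gives the coordinates.\<close>

lemma finite_basis:
  fixes U :: "('x \<Rightarrow> 'k::field) set"
  assumes zero: "(\<lambda>x. 0) \<in> U"
    and add: "\<And>f g. f \<in> U \<Longrightarrow> g \<in> U \<Longrightarrow> (\<lambda>x. f x + g x) \<in> U"
    and scale: "\<And>c f. f \<in> U \<Longrightarrow> (\<lambda>x. c * f x) \<in> U"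
    and Y: "finite Y" "\<And>f. f \<in> U \<Longrightarrow> (\<And>y. y \<in> Y \<Longrightarrow> f y = 0) \<Longrightarrow> f = (\<lambda>x. 0)"
  obtains r :: nat and b \<rho> where "\<And>i. i < r \<Longrightarrow> b i \<in> U"
    "\<And>f. f \<in> U \<Longrightarrow> f = (\<lambda>x. \<Sum>i<r. \<rho> f i * b i x)"
    "\<And>c j. j < r \<Longrightarrow> \<rho> (\<lambda>x. \<Sum>i<r. c i * b i x) j = c j"
proof -
  define sc where "sc = (\<lambda>(c :: 'k) (f :: 'x \<Rightarrow> 'k) x. c * f x)"
  interpret V: vector_space sc
    by standard (auto simp: sc_def fun_eq_iff algebra_simps)
  have sum_apply: "(\<Sum>i\<in>A. h i) x = (\<Sum>i\<in>A. h i x)" for h :: "'i \<Rightarrow> 'x \<Rightarrow> 'k" and A x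
    by (induction A rule: infinite_finite_induct) auto
  have sub: "V.subspace U"
  proof (rule V.subspaceI)
    show "0 \<in> U" using zero by (simp only: zero_fun_def)
    show "f + g \<in> U" if "f \<in> U" "g \<in> U" for f g
      using add[OF that] by (simp only: plus_fun_def)
    show "sc c f \<in> U" if "f \<in> U" for c f
      using scale[OF that] by (simp only: sc_def)
  qed
  obtain B where B: "B \<subseteq> U" "V.independent B" "U \<subseteq> V.span B"
    by (rule V.maximal_independent_subset[of U])
  have span: "V.span B = U"
    using V.span_minimal[OF B(1) sub] B(3) by blast
  \<comment> \<open>Restriction to \<open>Y\<close>, extended by zero so that it is an endomorphism
    of the space of functions.\<close>
  define res where "res f = (\<lambda>x. if x \<in> Y then f x else 0)" for f :: "'x \<Rightarrow> 'k"
  interpret res: module_hom sc sc res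
    by standard (auto simp: res_def sc_def fun_eq_iff)
  have inj: "inj_on res (V.span B)"
    unfolding res.inj_on_iff_eq_0[OF V.subspace_span]
  proof (intro ballI impI)
    fix f assume f: "f \<in> V.span B" "res f = 0"
    have "f y = 0" if "y \<in> Y" for y
      using that fun_cong[OF f(2), of y] by (simp add: res_def)
    then show "f = 0"
      using Y(2)[of f] f(1) unfolding span zero_fun_def by blast
  qed
  define \<delta> where "\<delta> y = (\<lambda>x. if x = y then 1 else 0 :: 'k)" for y :: 'x
  have "res f \<in> V.span (\<delta> ` Y)" for f
  proof -
    have "res f = (\<Sum>y\<in>Y. sc (f y) (\<delta> y))"
      using Y(1) by (auto simp: fun_eq_iff sum_apply sc_def res_def \<delta>_def if_distrib cong: if_cong)
    also have "\<dots> \<in> V.span (\<delta> ` Y)"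
      by (intro V.span_sum V.span_scale V.span_base) auto
    finally show ?thesis .
  qed
  moreover have "V.independent (res ` B)"
    by (rule res.independent_injective_image[OF B(2) inj])
  ultimately have "finite (res ` B)"
    using V.independent_span_bound[of "\<delta> ` Y" "res ` B"] Y(1) by blast
  moreover have "inj_on res B"
    by (rule inj_on_subset[OF inj V.span_superset])
  ultimately have fin: "finite B"
    by (rule finite_imageD)
  then obtain b where b: "bij_betw b {..<card B} B"
    using ex_bij_betw_nat_finite by (metis atLeast0LessThan)
  then have bB: "b i \<in> B" if "i < card B" for i
    using that by (auto simp: bij_betw_def)
  have reindex: "(\<Sum>v\<in>B. h v) = (\<Sum>i<card B. h (b i))" for h :: "('x \<Rightarrow> 'k) \<Rightarrow> 'x \<Rightarrow> 'k"
    by (rule sum.reindex_bij_betw[OF b, symmetric])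
  show ?thesis
  proof (rule that[of "card B" b "\<lambda>f i. V.representation B f (b i)"])
    show "b i \<in> U" if "i < card B" for i
      using bB[OF that] B(1) by blast
    show "f = (\<lambda>x. \<Sum>i<card B. V.representation B f (b i) * b i x)" if "f \<in> U" for f
    proof -
      have "(\<Sum>v\<in>B. sc (V.representation B f v) v) = f"
        using that B fin by (intro V.sum_representation_eq) auto
      then show ?thesis
        unfolding reindex by (auto simp: fun_eq_iff sum_apply sc_def)
    qed
    show "V.representation B (\<lambda>x. \<Sum>i<card B. c i * b i x) (b j) = c j" if j: "j < card B" for c j
    proof -
      have "(\<lambda>x. \<Sum>i<card B. c i * b i x) = (\<Sum>i<card B. sc (c i) (b i))"
        by (auto simp: fun_eq_iff sum_apply sc_def)
      moreover have "V.representation B (\<Sum>i<card B. sc (c i) (b i)) =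
          (\<lambda>v. \<Sum>i<card B. V.representation B (sc (c i) (b i)) v)"
        using bB by (intro V.representation_sum B V.span_scale V.span_base) auto
      moreover have "V.representation B (sc (c i) (b i)) (b j) = (if i = j then c i else 0)" if "i < card B" for i
        using bB[OF that] b j that
        by (auto simp: V.representation_scale[OF B(2) V.span_base] V.representation_basis[OF B(2)]
          bij_betw_def inj_on_def)
      ultimately show ?thesis
        using j by simp
    qed
  qed
qed

locale finite_torsion_free = assoc_conformal_algebra scale nprod
  for scale :: "'k::field_char_0 poly \<Rightarrow> 'c::ab_group_add \<Rightarrow> 'c" and nprod +
  fixes S :: "'c set"
  assumes finite_S: "finite S" and span_S: "span S = UNIV" and torsion_free: "torsion_free"
begin

text \<open>H is generated by its constants and D, so closure under sums, constants and D gives a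
  submodule.\<close>

lemma element_induct [case_names gen zero add const D]:
  assumes "\<And>s. s \<in> S \<Longrightarrow> P s" "P 0" "\<And>c d. P c \<Longrightarrow> P d \<Longrightarrow> P (c + d)"
    and "\<And>r c. P c \<Longrightarrow> P (scale [:r:] c)" "\<And>c. P c \<Longrightarrow> P (scale [:0, 1:] c)"
  shows "P c"
proof -
  have "P (scale h c)" if "P c" for h c
  proof (induction h)
    case (pCons r h)
    then show ?case
      unfolding scale_pCons[of r h] using that assms by blast
  qed (simp add: assms)
  then have "subspace (Collect P)"
    using assms by (auto intro!: subspaceI)
  then show ?thesis
    using span_induct[of c S P] assms(1) span_S by auto
qed

lemma nprod_0_left: "nprod n 0 c = 0"
  using nprod_add_left[of n 0 0 c] by simp

text \<open>The coefficient algebra of \<open>C\<close> is spanned by symbols \<open>c(n)\<close>.  A functional on it, extended by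
  a unit, is a function \<open>\<phi>\<close> whose value at \<open>c(n)\<close> is \<open>\<phi> (Some (n, c))\<close>, and at the unit \<open>\<phi> None\<close>;
  \<open>act b m\<close> is the right action of \<open>b(m)\<close>, the transpose of left multiplication.\<close>

definition functional :: "((nat \<times> 'c) option \<Rightarrow> 'k) \<Rightarrow> bool" where
  "functional \<phi> \<longleftrightarrow>
    (\<forall>n c d. \<phi> (Some (n, c + d)) = \<phi> (Some (n, c)) + \<phi> (Some (n, d))) \<and>
    (\<forall>n r c. \<phi> (Some (n, scale [:r:] c)) = r * \<phi> (Some (n, c))) \<and>
    (\<forall>n c. \<phi> (Some (n, scale [:0, 1:] c)) = - of_nat n * \<phi> (Some (n - 1, c)))"

definition act :: "'c \<Rightarrow> nat \<Rightarrow> ((nat \<times> 'c) option \<Rightarrow> 'k) \<Rightarrow> (nat \<times> 'c) option \<Rightarrow> 'k" where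
  "act b m \<phi> x = (case x of None \<Rightarrow> \<phi> (Some (m, b))
    | Some (n, c) \<Rightarrow> binsum m (\<lambda>s k. \<phi> (Some (n + s, nprod k b c))))"

lemma act_None [simp]: "act b m \<phi> None = \<phi> (Some (m, b))"
  and act_Some [simp]: "act b m \<phi> (Some (n, c)) = binsum m (\<lambda>s k. \<phi> (Some (n + s, nprod k b c)))"
  by (simp_all add: act_def)

lemma functional_add: "functional \<phi> \<Longrightarrow> \<phi> (Some (n, c + d)) = \<phi> (Some (n, c)) + \<phi> (Some (n, d))"
  and functional_const: "functional \<phi> \<Longrightarrow> \<phi> (Some (n, scale [:r:] c)) = r * \<phi> (Some (n, c))"
  and functional_D: "functional \<phi> \<Longrightarrow> \<phi> (Some (n, scale [:0, 1:] c)) = - of_nat n * \<phi> (Some (n - 1, c))"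
  by (auto simp: functional_def)

lemma functional_0: "functional \<phi> \<Longrightarrow> \<phi> (Some (n, 0)) = 0"
  using functional_add[of \<phi> n 0 0] by simp

lemma functional_minus: "functional \<phi> \<Longrightarrow> \<phi> (Some (n, - c)) = - \<phi> (Some (n, c))"
  using functional_add[of \<phi> n c "- c"] functional_0[of \<phi> n] by (simp add: eq_neg_iff_add_eq_0 add.commute)

lemma functional_of_nat:
  "functional \<phi> \<Longrightarrow> \<phi> (Some (n, scale (of_nat k) c)) = of_nat k * \<phi> (Some (n, c))"
  by (simp add: of_nat_poly functional_const)

lemma functional_sum: "functional \<phi> \<Longrightarrow> \<phi> (Some (n, sum f A)) = (\<Sum>i\<in>A. \<phi> (Some (n, f i)))"
  by (induction A rule: infinite_finite_induct) (auto simp: functional_0 functional_add)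

lemma functional_nprod_assoc:
  "functional \<phi> \<Longrightarrow> \<phi> (Some (l, nprod n a (nprod m b c))) =
    binsum n (\<lambda>s k. \<phi> (Some (l, nprod (m + s) (nprod k a b) c)))"
  by (simp add: nprod_assoc binsum_def functional_sum functional_of_nat)

text \<open>Only the relation for D needs work. The rule for D in the right factor gives sums with
  the factors \<open>- n\<close>, \<open>- s\<close> and \<open>k\<close>; by the two absorption
  identities the last two cancel.\<close>

lemma functional_act:
  assumes \<phi>: "functional \<phi>"
  shows "functional (act b m \<phi>)"
proof -
  have "act b m \<phi> (Some (n, scale [:0, 1:] c)) = - of_nat n * act b m \<phi> (Some (n - 1, c))" for n c
  proof -
    define h where "h s k = \<phi> (Some (n + s, nprod k b c))" for s k
    \<comment> \<open>Here and in the next fact, the factor is zero wherever truncated subtraction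
      matters.\<close>
    have n: "of_nat n * \<phi> (Some (n + s - 1, nprod k b c)) = of_nat n * \<phi> (Some (n - 1 + s, nprod k b c))" for s k
      by (cases n) auto
    have s: "of_nat s * \<phi> (Some (n + s - 1, nprod k b c)) = of_nat s * h (s - 1) k" for s k
      by (cases s) (auto simp: h_def)
    have "act b m \<phi> (Some (n, scale [:0, 1:] c)) =
        binsum m (\<lambda>s k. - (of_nat n * \<phi> (Some (n + s - 1, nprod k b c))) +
          (- (of_nat s * \<phi> (Some (n + s - 1, nprod k b c))) + of_nat k * h s (k - 1)))"
      by (simp add: nprod_D_right functional_add[OF \<phi>] functional_D[OF \<phi>] functional_of_nat[OF \<phi>]
        h_def algebra_simps)
    also have "\<dots> = - (of_nat n * act b m \<phi> (Some (n - 1, c)))"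
      unfolding n s binsum_add binsum_minus binsum_mult_left act_Some
        binsum_absorb[of m h, symmetric] binsum_absorb_left[of m h, symmetric] by simp
    finally show ?thesis by simp
  qed
  moreover have "act b m \<phi> (Some (n, c + d)) = act b m \<phi> (Some (n, c)) + act b m \<phi> (Some (n, d))" for n c d
    by (simp only: act_Some nprod_add_right functional_add[OF \<phi>] binsum_add)
  moreover have "act b m \<phi> (Some (n, scale [:r:] c)) = r * act b m \<phi> (Some (n, c))" for n r c
    by (simp only: act_Some nprod_scalar_right functional_const[OF \<phi>] binsum_mult_left)
  ultimately show ?thesis
    unfolding functional_def by blast
qed

text \<open>The law of a right action, the product \<open>a(n) b(m)\<close> of symbols being the sum
  of all \<open>binom(n, s) (a_(n-s) b)(m + s)\<close>. Associativity gives a triple umbral sum,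
  regrouped by \<open>binsum_assoc\<close> and \<open>binsum_binsum_add\<close>.\<close>

lemma act_act:
  assumes \<phi>: "functional \<phi>"
  shows "act b m (act a n \<phi>) x = binsum n (\<lambda>s k. act (nprod k a b) (m + s) \<phi> x)"
proof (cases x)
  case (Some y)
  obtain l c where y: "y = (l, c)" by fastforce
  have "act b m (act a n \<phi>) x =
      binsum m (\<lambda>t i. binsum n (\<lambda>s j. binsum j (\<lambda>v w. \<phi> (Some (l + t + s, nprod (i + v) (nprod w a b) c)))))"
    by (simp add: Some y functional_nprod_assoc[OF \<phi>])
  also have "\<dots> = binsum n (\<lambda>p w. binsum m (\<lambda>t i. binsum p
      (\<lambda>s v. \<phi> (Some (l + (t + s), nprod (i + v) (nprod w a b) c)))))"
    by (subst binsum_assoc, subst binsum_swap) (simp add: add.assoc)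
  also have "\<dots> = binsum n (\<lambda>p w. binsum (m + p) (\<lambda>u k. \<phi> (Some (l + u, nprod k (nprod w a b) c))))"
    by (subst binsum_binsum_add[where h = "\<lambda>u k. \<phi> (Some (l + u, nprod k (nprod w a b) c))" for w]) simp
  finally show ?thesis
    by (simp add: Some y)
qed simp

section \<open>Functionals bounded on the generators\<close>

definition bounded :: "nat \<Rightarrow> ((nat \<times> 'c) option \<Rightarrow> 'k) \<Rightarrow> bool" where
  "bounded K \<phi> \<longleftrightarrow> (\<forall>s\<in>S. \<forall>n\<ge>K. \<phi> (Some (n, s)) = 0)"

definition low :: "nat \<Rightarrow> nat \<Rightarrow> 'c \<Rightarrow> bool" where
  "low K N c \<longleftrightarrow> (\<forall>\<phi>. functional \<phi> \<longrightarrow> bounded K \<phi> \<longrightarrow> (\<forall>n\<ge>N. \<phi> (Some (n, c)) = 0))"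

lemma low_mono: "low K N c \<Longrightarrow> N \<le> M \<Longrightarrow> low K M c"
  unfolding low_def by (meson order_trans)

lemma low_0: "low K N 0"
  by (simp add: low_def functional_0)

lemma low_add: "low K N c \<Longrightarrow> low K N d \<Longrightarrow> low K N (c + d)"
  by (auto simp: low_def functional_add)

lemma low_const: "low K N c \<Longrightarrow> low K N (scale [:r:] c)"
  by (simp add: low_def functional_const)

lemma low_minus: "low K N c \<Longrightarrow> low K N (- c)"
  by (simp add: low_def functional_minus)

lemma low_D: "low K N c \<Longrightarrow> low K (Suc N) (scale [:0, 1:] c)"
  by (auto simp: low_def functional_D)

lemma ex_low: "\<exists>N. low K N c"
proof (induction c rule: element_induct)
  case (gen s)
  then have "low K K s"
    unfolding low_def bounded_def by blast
  then show ?case ..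
next
  case (add c d)
  then obtain N M where "low K N c" "low K M d" by blast
  then have "low K (max N M) (c + d)"
    by (meson low_add low_mono max.cobounded1 max.cobounded2)
  then show ?case ..
next
  case zero
  show ?case by (rule exI[of _ 0]) (rule low_0)
next
  case (const r c)
  then show ?case by (auto intro: low_const)
next
  case (D c)
  then show ?case by (auto intro: low_D)
qed

lemma ex_low_finite:
  assumes "finite X"
  shows "\<exists>N. \<forall>c\<in>X. low K N c"
  using assms
proof induction
  case (insert c X)
  obtain N M where NM: "low K N c" "\<forall>c\<in>X. low K M c"
    using insert ex_low by blast
  then have "low K (max N M) d" if "d \<in> insert c X" for d
    using that low_mono[of K N c "max N M"] low_mono[of K M d "max N M"] by auto
  then have "\<forall>d\<in>insert c X. low K (max N M) d" ..
  then show ?case ..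
qed simp

lemma finite_nprod_gen: "finite (range (\<lambda>p. nprod p b c))"
proof (rule finite_subset)
  show "range (\<lambda>p. nprod p b c) \<subseteq> insert 0 ((\<lambda>p. nprod p b c) ` {p. nprod p b c \<noteq> 0})"
    by auto
qed (simp add: nprod_locality)

text \<open>The bound is uniform in \<open>b\<close>: as \<open>(D b)_(p) c\<close> is a multiple of
  \<open>b_(p-1) c\<close>, it suffices to treat \<open>b\<close> in \<open>S\<close>, where
  locality leaves finitely many products.\<close>

lemma ex_low_nprod: "\<exists>N. \<forall>p b. \<forall>c\<in>S. low K N (nprod p b c)"
proof -
  have "finite (\<Union>b\<in>S. \<Union>c\<in>S. range (\<lambda>p. nprod p b c))"
    using finite_S finite_nprod_gen by auto
  from ex_low_finite[OF this] obtain N where N: "\<And>p b c. b \<in> S \<Longrightarrow> c \<in> S \<Longrightarrow> low K N (nprod p b c)"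
    by blast
  have "\<forall>p. \<forall>c\<in>S. low K N (nprod p b c)" for b
  proof (induction b rule: element_induct)
    case (D b)
    have "low K N (- scale (of_nat p) (nprod (p - 1) b c))" if "c \<in> S" for p c
      using D that unfolding of_nat_poly by (intro low_minus low_const) blast
    then show ?case
      by (simp add: nprod_D_left)
  qed (auto simp: N low_0 nprod_0_left nprod_add_left low_add nprod_scalar_left low_const)
  then show ?thesis by blast
qed

text \<open>The largest set of \<open>K\<close>-bounded functionals that is closed under every
  \<open>act b m\<close>; it serves as the space \<open>U\<close>.\<close>

definition stable :: "nat \<Rightarrow> ((nat \<times> 'c) option \<Rightarrow> 'k) set" where
  "stable K = {\<phi>. functional \<phi> \<and> bounded K \<phi> \<and> (\<forall>b m. bounded K (act b m \<phi>))}"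

text \<open>By \<open>act_act\<close>, acting twice is a combination of single actions.\<close>

lemma act_stable:
  assumes "\<phi> \<in> stable K"
  shows "act a n \<phi> \<in> stable K"
proof -
  have \<phi>: "functional \<phi>" "\<And>b m. bounded K (act b m \<phi>)"
    using assms by (auto simp: stable_def)
  have "bounded K (act b m (act a n \<phi>))" for b m
    unfolding bounded_def act_act[OF \<phi>(1)] using \<phi>(2) by (simp add: bounded_def)
  then show ?thesis
    using \<phi> by (simp add: stable_def functional_act)
qed

text \<open>The value of \<open>act b m \<phi>\<close> at \<open>c(n)\<close> combines values of
  \<open>\<phi>\<close> at symbols \<open>(b_(k) c)(n + t)\<close>, which by
  \<open>ex_low_nprod\<close> vanish for large \<open>n\<close>, uniformly in
  \<open>b\<close>.\<close>

lemma ex_stable: "\<exists>K. \<forall>\<phi>. functional \<phi> \<longrightarrow> bounded K0 \<phi> \<longrightarrow> \<phi> \<in> stable K"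
proof -
  obtain N where N: "\<And>p b c. c \<in> S \<Longrightarrow> low K0 N (nprod p b c)"
    using ex_low_nprod by blast
  have "\<phi> \<in> stable (max K0 N)" if \<phi>: "functional \<phi>" "bounded K0 \<phi>" for \<phi>
  proof -
    have "\<phi> (Some (n + t, nprod k b c)) = 0" if "c \<in> S" "N \<le> n" for n t k b c
      using N[OF that(1)] \<phi> that(2) unfolding low_def by simp
    then have "bounded (max K0 N) (act b m \<phi>)" for b m
      by (simp add: bounded_def)
    moreover have "bounded (max K0 N) \<phi>"
      using \<phi> by (simp add: bounded_def)
    ultimately show ?thesis
      using \<phi> by (simp add: stable_def)
  qed
  then show ?thesis by blast
qed

lemma functional_eq_0:
  assumes "functional \<phi>" "\<And>n s. s \<in> S \<Longrightarrow> \<phi> (Some (n, s)) = 0" "\<phi> None = 0"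
  shows "\<phi> = (\<lambda>x. 0)"
proof -
  have "\<forall>n. \<phi> (Some (n, c)) = 0" for c
    by (induction c rule: element_induct)
      (use assms in \<open>auto simp: functional_0 functional_add functional_const functional_D\<close>)
  then show ?thesis
    using assms(3) by (metis not_None_eq surj_pair)
qed

text \<open>At a symbol \<open>(b_(k) s)(n + t)\<close> with \<open>t + k = m\<close>, either
  \<open>k\<close> is large and \<open>b_(k) s = 0\<close> by locality, or \<open>t\<close> is large
  and the functional vanishes there. Neither bound depends on the functional.\<close>

lemma act_eventually_0: "\<exists>M. \<forall>m\<ge>M. \<forall>\<phi>\<in>stable K. act b m \<phi> = (\<lambda>x. 0)"
proof -
  obtain N1 where N1: "low K N1 b"
    using ex_low by blast
  obtain N2 where N2: "\<And>p c. c \<in> S \<Longrightarrow> low K N2 (nprod p b c)"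
    using ex_low_nprod by blast
  define P where "P = (\<Union>c\<in>S. {p. nprod p b c \<noteq> 0})"
  have "finite P"
    using finite_S nprod_locality by (auto simp: P_def)
  then obtain L where "\<forall>p\<in>P. p < L"
    unfolding finite_nat_set_iff_bounded by blast
  then have L: "nprod p b c = 0" if "c \<in> S" "L \<le> p" for c p
    using that unfolding P_def by (meson UN_I mem_Collect_eq not_less)
  have "act b m \<phi> = (\<lambda>x. 0)" if m: "max N1 (L + N2) \<le> m" and \<phi>: "\<phi> \<in> stable K" for m \<phi>
  proof (rule functional_eq_0)
    have \<phi>': "functional \<phi>" "bounded K \<phi>"
      using \<phi> by (auto simp: stable_def)
    show "functional (act b m \<phi>)"
      by (rule functional_act[OF \<phi>'(1)])
    show "act b m \<phi> None = 0"
      using N1 m \<phi>' by (simp add: low_def)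
    fix n s assume s: "s \<in> S"
    have "\<phi> (Some (n + t, nprod k b s)) = 0" if "t + k = m" for t k
    proof (cases "L \<le> k")
      case True
      then show ?thesis by (simp add: L s functional_0 \<phi>')
    next
      case False
      then have "N2 \<le> n + t" using m that by auto
      then show ?thesis using N2[OF s] \<phi>' by (simp add: low_def)
    qed
    then have "binsum m (\<lambda>t k. \<phi> (Some (n + t, nprod k b s))) = binsum m (\<lambda>t k. 0)"
      by (rule binsum_cong)
    then show "act b m \<phi> (Some (n, s)) = 0"
      by simp
  qed
  then show ?thesis by blast
qed

text \<open>A maximal independent set \<open>B\<close> of generators spans the module up to torsion; the coordinates
  with respect to \<open>B\<close> provide enough functionals, so no basis of the whole module is needed.\<close>

lemma ex_coordinates:
  obtains h B where "h \<noteq> 0" "finite B" "independent B" "\<And>c. scale h c \<in> span B"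
proof -
  define F where "F = {B. B \<subseteq> S \<and> independent B}"
  have "finite F" "{} \<in> F"
    unfolding F_def using finite_S independent_empty by simp_all
  from finite_has_maximal2[OF this] obtain B where "B \<in> F"
    and max: "\<forall>B'\<in>F. B \<subseteq> B' \<longrightarrow> B = B'"
    by (elim bexE conjE)
  then have B: "B \<subseteq> S" "independent B"
    by (auto simp: F_def)
  then have fin: "finite B"
    using finite_S finite_subset by blast
  have "\<exists>h. h \<noteq> 0 \<and> scale h s \<in> span B" if s: "s \<in> S" for s
  proof (cases "s \<in> B")
    case True
    then show ?thesis
      by (intro exI[of _ 1]) (auto intro: span_base)
  next
    case False
    then have "dependent (insert s B)"
      using max[rule_format, of "insert s B"] B s by (auto simp: F_def)
    then obtain u where u: "\<exists>v\<in>insert s B. u v \<noteq> 0" "scale (u s) s + (\<Sum>v\<in>B. scale (u v) v) = 0"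
      using False fin by (auto simp: dependent_finite)
    have "u s \<noteq> 0"
    proof
      assume "u s = 0"
      then show False
        using u independentD[OF B(2) fin order_refl, of u] by auto
    qed
    have "scale (u s) s = - (\<Sum>v\<in>B. scale (u v) v)"
      using u(2) by (simp add: eq_neg_iff_add_eq_0)
    moreover have "(\<Sum>v\<in>B. scale (u v) v) \<in> span B"
      by (intro span_sum span_scale span_base)
    ultimately have "scale (u s) s \<in> span B"
      by (simp add: span_neg)
    with \<open>u s \<noteq> 0\<close> show ?thesis by blast
  qed
  then obtain g where g: "\<And>s. s \<in> S \<Longrightarrow> g s \<noteq> 0 \<and> scale (g s) s \<in> span B"
    by metis
  show ?thesis
  \<comment> \<open>The product of the multipliers works for all generators at once.\<close>
  proof (rule that[of "prod g S" B])
    show "prod g S \<noteq> 0"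
      using g finite_S by simp
    fix c
    have "c \<in> span S" using span_S by simp
    then show "scale (prod g S) c \<in> span B"
    proof (induction rule: span_induct)
      case base
      show ?case
        by (rule subspaceI) (auto simp: scale_right_distrib span_zero span_add
          scale_left_commute[of "prod g S"] simp del: scale_scale intro: span_scale)
    next
      case (step s)
      then have "prod g S = prod g (S - {s}) * g s"
        using finite_S by (simp add: prod.remove mult.commute)
      then show ?case
        using g[OF step] by (simp add: span_scale flip: scale_scale)
    qed
  qed (use fin B in auto)
qed

text \<open>The coordinates of \<open>h c\<close> with respect to \<open>B\<close> are polynomials
  in D, and their coefficients, suitably scaled, are values of functionals at the symbols
  \<open>c(n)\<close>. Without torsion \<open>h c\<close> is nonzero for nonzero \<open>c\<close>,
  so some coefficient is nonzero.\<close>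

lemma ex_separating_functionals:
  "\<exists>K. \<forall>c. c \<noteq> 0 \<longrightarrow> (\<exists>\<phi> n. functional \<phi> \<and> bounded K \<phi> \<and> \<phi> (Some (n, c)) \<noteq> 0)"
proof -
  obtain h B where h: "h \<noteq> 0" "finite B" "independent B" "\<And>c. scale h c \<in> span B"
    using ex_coordinates by blast
  define co where "co v c = representation B (scale h c) v" for v c
  have co_add: "co v (c + d) = co v c + co v d" for v c d
    using h by (simp add: co_def scale_right_distrib representation_add)
  have co_scale: "co v (scale g c) = g * co v c" for v g c
    using h by (simp add: co_def scale_left_commute[of h] representation_scale del: scale_scale)
  \<comment> \<open>The factor \<open>(-1)^n n!\<close> turns multiplication of a coordinate by D, a
    shift of coefficients, into the rule \<open>(D c)(n) = - n c(n - 1)\<close>.\<close>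
  define \<phi> where "\<phi> v x = (case x of None \<Rightarrow> 0
    | Some (n, c) \<Rightarrow> (-1) ^ n * fact n * coeff (co v c) n)" for v and x :: "(nat \<times> 'c) option"
  have functional: "functional (\<phi> v)" for v
    unfolding functional_def
  proof (intro conjI allI)
    show "\<phi> v (Some (n, c + d)) = \<phi> v (Some (n, c)) + \<phi> v (Some (n, d))" for n c d
      by (simp add: \<phi>_def co_add distrib_left)
    show "\<phi> v (Some (n, scale [:r:] c)) = r * \<phi> v (Some (n, c))" for n r c
      by (simp add: \<phi>_def co_scale)
    show "\<phi> v (Some (n, scale [:0, 1:] c)) = - of_nat n * \<phi> v (Some (n - 1, c))" for n c
      by (cases n) (simp_all add: \<phi>_def co_scale algebra_simps)
  qed
  \<comment> \<open>Chosen to exceed the degrees of all coordinates of all generators.\<close>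
  define K where "K = (\<Sum>v\<in>B. \<Sum>s\<in>S. Suc (degree (co v s)))"
  have bounded: "bounded K (\<phi> v)" if v: "v \<in> B" for v
    unfolding bounded_def
  proof (intro ballI allI impI)
    fix s n assume s: "s \<in> S" "K \<le> n"
    have "Suc (degree (co v s)) \<le> (\<Sum>s\<in>S. Suc (degree (co v s)))"
      using s finite_S by (intro member_le_sum) auto
    also have "\<dots> \<le> K"
      unfolding K_def using v h by (intro member_le_sum[where f = "\<lambda>v. \<Sum>s\<in>S. Suc (degree (co v s))"]) auto
    finally show "\<phi> v (Some (n, s)) = 0"
      using s by (simp add: \<phi>_def coeff_eq_0)
  qed
  have "\<exists>v\<in>B. \<exists>n. \<phi> v (Some (n, c)) \<noteq> 0" if "c \<noteq> 0" for c
  proof -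
    have "scale h c \<noteq> 0"
      using torsion_free that h by (auto simp: torsion_free_def)
    moreover have "(\<Sum>v\<in>B. scale (co v c) v) = scale h c"
      unfolding co_def by (rule sum_representation_eq[OF h(3,4,2) order_refl])
    ultimately have "(\<Sum>v\<in>B. scale (co v c) v) \<noteq> 0"
      by simp
    then obtain v where "v \<in> B" "scale (co v c) v \<noteq> 0"
      by (rule sum.not_neutral_contains_not_neutral)
    then have "v \<in> B" "co v c \<noteq> 0"
      by auto
    then show ?thesis
      by (intro bexI[of _ v] exI[of _ "degree (co v c)"]) (auto simp: \<phi>_def)
  qed
  then show ?thesis
    using functional bounded by blast
qed

section \<open>Linearity of the action and of the stable functionals\<close>

lemma act_add: "functional \<phi> \<Longrightarrow> act (c + d) m \<phi> x = act c m \<phi> x + act d m \<phi> x"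
  by (auto simp: act_def functional_add nprod_add_left binsum_add split: option.splits)

lemma act_const: "functional \<phi> \<Longrightarrow> act (scale [:r:] c) m \<phi> x = r * act c m \<phi> x"
  by (auto simp: act_def functional_const nprod_scalar_left binsum_mult_left split: option.splits)

lemma act_D:
  assumes "functional \<phi>"
  shows "act (scale [:0, 1:] c) m \<phi> x = - of_nat m * act c (m - 1) \<phi> x"
proof (cases x)
  case None
  then show ?thesis using functional_D[OF assms] by simp
next
  case (Some y)
  obtain n d where y: "y = (n, d)" by fastforce
  have "act (scale [:0, 1:] c) m \<phi> x =
      binsum m (\<lambda>s k. - (of_nat k * \<phi> (Some (n + s, nprod (k - 1) c d))))"
    by (simp add: Some y nprod_D_left functional_minus[OF assms] functional_of_nat[OF assms])
  also have "\<dots> = - (of_nat m * binsum (m - 1) (\<lambda>s k. \<phi> (Some (n + s, nprod k c d))))"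
    unfolding binsum_minus binsum_absorb ..
  finally show ?thesis by (simp add: Some y)
qed

lemma act_sum: "act b m (\<lambda>x. \<Sum>i\<in>I. c i * h i x) y = (\<Sum>i\<in>I. c i * act b m (h i) y)"
  by (auto simp: act_def binsum_sum binsum_mult_left split: option.splits)

lemma stable_add:
  assumes "\<phi> \<in> stable K" "\<psi> \<in> stable K"
  shows "(\<lambda>x. \<phi> x + \<psi> x) \<in> stable K"
proof -
  have act: "act b m (\<lambda>x. \<phi> x + \<psi> x) y = act b m \<phi> y + act b m \<psi> y" for b m y
    by (auto simp: act_def binsum_add split: option.splits)
  have "bounded K (act b m (\<lambda>x. \<phi> x + \<psi> x))" for b m
    using assms unfolding stable_def bounded_def act by simp
  then show ?thesis
    using assms by (auto simp: stable_def functional_def bounded_def algebra_simps simp del: act_Some)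
qed

lemma stable_scale:
  assumes "\<phi> \<in> stable K"
  shows "(\<lambda>x. r * \<phi> x) \<in> stable K"
proof -
  have act: "act b m (\<lambda>x. r * \<phi> x) y = r * act b m \<phi> y" for b m y
    by (auto simp: act_def binsum_mult_left split: option.splits)
  have "bounded K (act b m (\<lambda>x. r * \<phi> x))" for b m
    using assms unfolding stable_def bounded_def act by simp
  then show ?thesis
    using assms by (auto simp: stable_def functional_def bounded_def algebra_simps simp del: act_Some)
qed

text \<open>This functional keeps the space nonzero even for \<open>C = 0\<close>, so that the
  matrices have positive size.\<close>

lemma unit_functional_stable: "(\<lambda>x. if x = None then 1 else 0) \<in> stable K"
  by (auto simp: stable_def functional_def bounded_def)

theorem embeds_into_current_algebra:
  obtains mul one xi R f where "poly_algebra mul one xi R"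
    "conformal_hom scale nprod scl (poly_algebra.cprod mul) f" "inj f"
proof -
  obtain K0 where K0: "\<And>c. c \<noteq> 0 \<Longrightarrow> \<exists>\<phi> n. functional \<phi> \<and> bounded K0 \<phi> \<and> \<phi> (Some (n, c)) \<noteq> 0"
    using ex_separating_functionals by blast
  obtain K where K: "\<And>\<phi>. functional \<phi> \<Longrightarrow> bounded K0 \<phi> \<Longrightarrow> \<phi> \<in> stable K"
    using ex_stable[of K0] by blast
  have stable: "functional \<phi>" "bounded K \<phi>" if "\<phi> \<in> stable K" for \<phi>
    using that by (auto simp: stable_def)
  have zero: "(\<lambda>x. 0) \<in> stable K"
    using stable_scale[OF unit_functional_stable, of 0] by simp
  \<comment> \<open>The finitely many values at the unit and at \<open>s(n)\<close> with
    \<open>n < K\<close> determine a stable functional; this makes \<open>finite_basis\<close>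
    applicable.\<close>
  have det: "\<phi> = (\<lambda>x. 0)"
    if \<phi>: "\<phi> \<in> stable K" and Y: "\<And>y. y \<in> insert None (Some ` ({..<K} \<times> S)) \<Longrightarrow> \<phi> y = 0" for \<phi>
  proof (rule functional_eq_0[OF stable(1)[OF \<phi>]])
    show "\<phi> (Some (n, s)) = 0" if "s \<in> S" for n s
      using stable(2)[OF \<phi>] Y that by (cases "n < K") (auto simp: bounded_def)
  qed (use Y in auto)
  have "finite (insert None (Some ` ({..<K} \<times> S)))"
    using finite_S by simp
  from finite_basis[OF zero stable_add stable_scale this det]
  obtain r :: nat and b \<rho> where b: "\<And>i. i < r \<Longrightarrow> b i \<in> stable K"
    and \<rho>: "\<And>\<phi>. \<phi> \<in> stable K \<Longrightarrow> \<phi> = (\<lambda>x. \<Sum>i<r. \<rho> \<phi> i * b i x)"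
    and \<rho>_unique: "\<And>c j. j < r \<Longrightarrow> \<rho> (\<lambda>x. \<Sum>i<r. c i * b i x) j = c j"
    by blast
  have "r > 0"
  proof (rule ccontr)
    assume "\<not> r > 0"
    then show False
      using fun_cong[OF \<rho>[OF unit_functional_stable], of None] by simp
  qed
  then interpret M: matrix_poly r by unfold_locales
  interpret A: poly_algebra M.mmul "M.scalar_matrix 1" "M.scalar_matrix (monom 1 1)" "r * r"
    by (rule M.poly_algebra_mmul)
  \<comment> \<open>Row \<open>i\<close> holds the coordinates of \<open>b i\<close> acted on by
    \<open>c(m)\<close>. As the action is a right action, matrix products follow the order of the
    products of symbols.\<close>
  define A where "A c m i j = \<rho> (act c m (b i)) j" for c m i j
  have act_b: "act c m (b i) x = (\<Sum>j<r. A c m i j * b j x)" if "i < r" for c m i x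
    using fun_cong[OF \<rho>[OF act_stable[OF b[OF that]]]] by (simp add: A_def)
  \<comment> \<open>Coordinates are unique, so identities for the action on the basis become
    identities of matrices.\<close>
  have A_eqI: "A c m i j = a j" if "i < r" "j < r" "\<And>x. act c m (b i) x = (\<Sum>j<r. a j * b j x)" for c m i j a
    unfolding A_def using \<rho>_unique[OF that(2), of a] that(3) by presburger
  define \<tau> where "\<tau> c m = M.const_matrix (A c m)" for c m
  have "\<exists>f. conformal_hom scale nprod scl A.cprod f \<and> inj f"
  proof (rule A.embedding[where \<tau> = \<tau>])
    show "assoc_conformal_algebra scale nprod" ..
    show "\<tau> (c + d) m = \<tau> c m + \<tau> d m" for c d m
      unfolding \<tau>_def M.const_matrix_add[symmetric]
      by (intro M.const_matrix_cong A_eqI)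
        (simp_all only: act_add[OF stable(1)[OF b]], simp_all add: act_b distrib_right sum.distrib)
    show "\<tau> (scale [:a:] c) m = smult a (\<tau> c m)" for a c m
      unfolding \<tau>_def M.const_matrix_smult[symmetric]
      by (intro M.const_matrix_cong A_eqI)
        (simp_all only: act_const[OF stable(1)[OF b]], simp_all add: act_b sum_distrib_left mult.assoc)
    show "\<tau> (scale [:0, 1:] c) m = smult (- of_nat m) (\<tau> c (m - 1))" for c m
      unfolding \<tau>_def M.const_matrix_smult[symmetric]
      by (intro M.const_matrix_cong A_eqI)
        (simp_all only: act_D[OF stable(1)[OF b]], simp_all add: act_b sum_distrib_left mult.assoc sum_negf)
    show "\<exists>M. \<forall>m\<ge>M. \<tau> c m = 0" for c
    proof -
      obtain N where N: "\<forall>m\<ge>N. \<forall>\<phi>\<in>stable K. act c m \<phi> = (\<lambda>x. 0)"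
        using act_eventually_0 by blast
      have "A c m i j = 0" if "N \<le> m" "i < r" "j < r" for m i j
        by (rule A_eqI) (use N b that in auto)
      then have "\<forall>m\<ge>N. \<tau> c m = 0"
        by (simp add: \<tau>_def M.const_matrix_eq_0_iff)
      then show ?thesis ..
    qed
    show "M.mmul (\<tau> a n) (\<tau> d m) = binsum n (\<lambda>s k. \<tau> (nprod k a d) (m + s))" for a d n m
      unfolding \<tau>_def M.mmul_const_matrix M.const_matrix_binsum[symmetric]
    proof (rule M.const_matrix_cong)
      fix i j assume ij: "i < r" "j < r"
      have "act d m (act a n (b i)) x = (\<Sum>j<r. (\<Sum>k<r. A a n i k * A d m k j) * b j x)" for x
      proof -
        have "act a n (b i) = (\<lambda>x. \<Sum>k<r. A a n i k * b k x)"
          using act_b[OF ij(1)] by blast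
        then have "act d m (act a n (b i)) x = (\<Sum>k<r. \<Sum>j<r. A a n i k * A d m k j * b j x)"
          by (simp add: act_sum act_b sum_distrib_left mult.assoc)
        also have "\<dots> = (\<Sum>j<r. \<Sum>k<r. A a n i k * A d m k j * b j x)"
          by (rule sum.swap)
        finally show ?thesis
          by (simp add: sum_distrib_right)
      qed
      moreover have "act d m (act a n (b i)) x =
          (\<Sum>j<r. binsum n (\<lambda>s k. A (nprod k a d) (m + s) i j) * b j x)" for x
        unfolding act_act[OF stable(1)[OF b[OF ij(1)]]] act_b[OF ij(1)] binsum_sum
        by (simp add: mult.commute[of _ "b _ x"] binsum_mult_left)
      ultimately have eq: "(\<lambda>x. \<Sum>j<r. (\<Sum>k<r. A a n i k * A d m k j) * b j x) =
          (\<lambda>x. \<Sum>j<r. binsum n (\<lambda>s k. A (nprod k a d) (m + s) i j) * b j x)"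
        by auto
      show "(\<Sum>k<r. A a n i k * A d m k j) = binsum n (\<lambda>s k. A (nprod k a d) (m + s) i j)"
        using \<rho>_unique[OF ij(2), of "\<lambda>j. \<Sum>k<r. A a n i k * A d m k j"]
          \<rho>_unique[OF ij(2), of "\<lambda>j. binsum n (\<lambda>s k. A (nprod k a d) (m + s) i j)"]
        unfolding eq by simp
    qed
    show "c = 0" if "\<And>m. \<tau> c m = 0" for c
    proof (rule ccontr)
      assume "c \<noteq> 0"
      then obtain \<phi> n where \<phi>: "functional \<phi>" "bounded K0 \<phi>" "\<phi> (Some (n, c)) \<noteq> 0"
        using K0 by blast
      have "A c n i j = 0" if "i < r" "j < r" for i j
        using \<open>\<tau> c n = 0\<close> that by (simp add: \<tau>_def M.const_matrix_eq_0_iff)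
      then have "act c n (b i) x = 0" if "i < r" for i x
        using that by (simp add: act_b)
      \<comment> \<open>At the unit, the action of \<open>c(n)\<close> on \<open>\<phi>\<close>
        takes the value of \<open>\<phi>\<close> at \<open>c(n)\<close>; this is why a unit was
        adjoined to the coefficient algebra.\<close>
      then have "act c n (\<lambda>x. \<Sum>i<r. \<rho> \<phi> i * b i x) None = 0"
        unfolding act_sum by (simp del: act_None)
      then show False
        using \<rho>[OF K[OF \<phi>(1,2)]] \<phi>(3) by simp
    qed
  qed
  then show ?thesis
    using that A.poly_algebra_axioms by blast
qed

end

theorem corollary1:
  fixes scale :: "'k::field_char_0 poly \<Rightarrow> 'c::ab_group_add \<Rightarrow> 'c"
    and nprod :: "nat \<Rightarrow> 'c \<Rightarrow> 'c \<Rightarrow> 'c"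
  assumes "assoc_conformal_algebra scale nprod"
    and "conformal_algebra.finite_algebra scale"
    and "conformal_algebra.torsion_free scale"
  shows "\<exists>(scale' :: 'k poly \<Rightarrow> 'k poly poly \<Rightarrow> 'k poly poly)
           (nprod' :: nat \<Rightarrow> 'k poly poly \<Rightarrow> 'k poly poly \<Rightarrow> 'k poly poly)
           (f :: 'c \<Rightarrow> 'k poly poly).
      assoc_conformal_algebra scale' nprod' \<and>
      conformal_algebra.finitely_generated scale' nprod' \<and>
      conformal_algebra.gk_dim scale' nprod' \<le> 1 \<and>
      (\<exists>e. conformal_algebra.two_sided_unit scale' nprod' e) \<and>
      conformal_hom scale nprod scale' nprod' f \<and> inj f"
proof -
  interpret C: assoc_conformal_algebra scale nprod
    by (rule assms(1))
  obtain S where "finite S" "C.span S = UNIV"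
    using assms(2) by (auto simp: C.finite_algebra_def)
  then interpret finite_torsion_free scale nprod S
    using assms(3) by unfold_locales
  obtain mul one xi R f where A: "poly_algebra mul one xi R"
    and f: "conformal_hom scale nprod scl (poly_algebra.cprod mul) f" "inj f"
    by (rule embeds_into_current_algebra)
  interpret poly_algebra mul one xi R
    by (rule A)
  show ?thesis
    using current.assoc_conformal_algebra_axioms finitely_generated gk_dim_le_1 two_sided_unit_one f
    by blast
qed

end
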